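(* Let $1\le m\le n$, $\pi\in\mathfrak S_{m,n}$ and $\beta\in\{\mathsf w,\mathsf e\}^m$. The $B$-leading form of $G^\beta_\pi$ (the sum of its terms containing the maximal power of $B$) is \[B^{mn-\ell(\hat\pi)}\,S^\beta_\pi(A+x_1,\dots,A+x_m,y_1,\dots,y_n).\] Furthermore, only nongeneric hybrid pipe dreams contribute to this $B$-leading form, and the $B$-leading form of the weight of each nongeneric hybrid pipe dream of type $\beta$ with connectivity $\pi$ equals $B^{mn-\ell(\hat\pi)}$ times its contribution to $S^\beta_\pi$ evaluated at $x_k\mapsto A+x_k$.
   Context: $\mathfrak S_{m,n}$ is the set of injective maps $\pi:\{1,\dots,m\}\to\{1,\dots,n\}$. For $\pi\in\mathfrak S_{m,n}$ let $j_1<\dots<j_{n-m}$ be the elements of $\{1,\dots,n\}$ not in the image of $\pi$ and define $\hat\pi\in\mathfrak S_n$ by $\hat\pi(i)=\pi(i)$ ($i\le m$), $\hat\pi(m+k)=j_k$. $\ell(w)=\#\{i<j: w(i)>w(j)\}$ is the number of inversions. Row $i$ of an $m\times n$ grid has type $\beta_i$. A hybrid generic pipe dream of type $\beta$ fills the grid with tiles (unit squares in which pipes join edge midpoints). Rows of type $\mathsf w$ allow: blank; straight tiles horizontal (West–East), vertical (South–North), cross; elbow tiles West–North, South–East, double elbow (both). Rows of type $\mathsf e$ allow: blank; the same straight tiles; elbow tiles East–North, South–West, double elbow (both). Conditions: no pipe starts or ends inside the grid; each $\mathsf w$ row has a pipe entering through its West boundary edge and none exiting East; each $\mathsf e$ row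 has a pipe entering through its East boundary edge and none exiting West; no pipe crosses the South boundary; double crossings are allowed. Pipes are numbered counterclockwise from the northwest corner (West-entering $1,\dots,k$ top to bottom, East-entering $k+1,\dots,m$ bottom to top); $\varphi(i)$ is the number of the pipe entering row $i$; the connectivity is $\pi$ with pipe $i$ exiting North in column $\pi(i)$. The weight of such a pipe dream is the product over tiles at $(i,j)$ of: $A+B$ for elbows; if $\beta_i=\mathsf w$, $B-x_{\varphi(i)}+y_j$ for blank and $A+x_{\varphi(i)}-y_j$ for straight tiles; if $\beta_i=\mathsf e$, $A+x_{\varphi(i)}-y_j$ for blank and $B-x_{\varphi(i)}+y_j$ for straight tiles; $G^\beta_\pi$ is the sum of weights over those of type $\beta$ with connectivity $\pi$. A nongeneric hybrid pipe dream is a hybrid generic pipe dream with no vertical tile in $\mathsf w$ rows, no double elbow in $\mathsf e$ rows, and no two pipes crossing twice; $S^\beta_\pi\in\mathbb Z[x_1,\dots,x_m,y_1,\dots,y_n]$ is the sum over nongeneric ones of type $\beta$ and connectivity $\pi$ of the product over tiles of: $x_{\varphi(i)}-y_j$ for straight tiles if $\beta_i=\mathsf w$, $x_{\varphi(i)}-y_j$ for blank tiles if $\beta_i=\mathsf e$, and $1$ otherwise. *)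

theory Defs
  imports "HOL-Library.Poly_Mapping" "HOL-Library.FuncSet"
begin

subsection \<open>Polynomials in \<open>A, B, x\<^sub>1, x\<^sub>2, \<dots>, y\<^sub>1, y\<^sub>2, \<dots>\<close> over the integers\<close>

datatype var = VA | VB | VX nat | VY nat

text \<open>
  A monomial is a finitely supported exponent vector, and a polynomial is a finitely supported
  map from monomials to integers.
\<close>

type_synonym monom = "var \<Rightarrow>\<^sub>0 nat"
type_synonym poly = "monom \<Rightarrow>\<^sub>0 int"

definition Var :: "var \<Rightarrow> poly" where
  "Var v = Poly_Mapping.single (Poly_Mapping.single v 1) 1"

abbreviation A :: poly where "A \<equiv> Var VA"
abbreviation B :: poly where "B \<equiv> Var VB"
abbreviation X :: "nat \<Rightarrow> poly" where "X k \<equiv> Var (VX k)"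
abbreviation Y :: "nat \<Rightarrow> poly" where "Y k \<equiv> Var (VY k)"

definition substitute :: "(var \<Rightarrow> poly) \<Rightarrow> poly \<Rightarrow> poly" where
  "substitute f p =
     (\<Sum>t\<in>Poly_Mapping.keys p.
        of_int (Poly_Mapping.lookup p t) *
        (\<Prod>v\<in>Poly_Mapping.keys t. f v ^ Poly_Mapping.lookup t v))"

fun shift_var :: "var \<Rightarrow> poly" where
  "shift_var (VX k) = A + X k"
| "shift_var v = Var v"

text \<open>The substitution \<open>x\<^sub>k \<mapsto> A + x\<^sub>k\<close> for all \<open>k\<close>, fixing every other variable.\<close>

definition shift :: "poly \<Rightarrow> poly" where
  "shift = substitute shift_var"

text \<open>The convention \<open>B_degree 0 = 0\<close> is immaterial for \<open>B_leading_form\<close>.\<close>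

definition B_degree :: "poly \<Rightarrow> nat" where
  "B_degree p = Max (insert 0 ((\<lambda>t. Poly_Mapping.lookup t VB) ` Poly_Mapping.keys p))"

definition B_leading_form :: "poly \<Rightarrow> poly" where
  "B_leading_form p =
     (\<Sum>t\<in>{t \<in> Poly_Mapping.keys p. Poly_Mapping.lookup t VB = B_degree p}.
        Poly_Mapping.single t (Poly_Mapping.lookup p t))"

subsection \<open>Partial permutations\<close>

text \<open>Only the values of \<open>\<pi>\<close> on \<open>{1..m}\<close> are relevant.\<close>

definition partial_perm :: "nat \<Rightarrow> nat \<Rightarrow> (nat \<Rightarrow> nat) \<Rightarrow> bool" where
  "partial_perm m n \<pi> \<longleftrightarrow> \<pi> \<in> {1..m} \<rightarrow> {1..n} \<and> inj_on \<pi> {1..m}"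

definition completion :: "nat \<Rightarrow> nat \<Rightarrow> (nat \<Rightarrow> nat) \<Rightarrow> nat \<Rightarrow> nat" where
  "completion m n \<pi> i =
     (if i \<le> m then \<pi> i else sorted_list_of_set ({1..n} - \<pi> ` {1..m}) ! (i - m - 1))"

text \<open>
  The completion increases on \<open>{m+1..n}\<close>, so each of its inversions \<open>(i, j)\<close> has \<open>i \<le> m\<close>, and
  the difference of \<open>m * n\<close> and their number never truncates.
\<close>

definition inversions :: "nat \<Rightarrow> (nat \<Rightarrow> nat) \<Rightarrow> nat" where
  "inversions n w = card {(i, j). 1 \<le> i \<and> i < j \<and> j \<le> n \<and> w i > w j}"

subsection \<open>Tiles and pipe dreams\<close>

datatype row_type = W_row | E_row

datatype side = North | East | South | West

datatype tile = Blank | Horizontal | Vertical | Cross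
  | Elbow_WN | Elbow_SE | Double_WN_SE
  | Elbow_EN | Elbow_SW | Double_EN_SW

fun segments :: "tile \<Rightarrow> (side \<times> side) set" where
  "segments Blank = {}"
| "segments Horizontal = {(West, East)}"
| "segments Vertical = {(South, North)}"
| "segments Cross = {(West, East), (South, North)}"
| "segments Elbow_WN = {(West, North)}"
| "segments Elbow_SE = {(South, East)}"
| "segments Double_WN_SE = {(West, North), (South, East)}"
| "segments Elbow_EN = {(East, North)}"
| "segments Elbow_SW = {(South, West)}"
| "segments Double_EN_SW = {(East, North), (South, West)}"

definition straight :: "tile \<Rightarrow> bool" where
  "straight t \<longleftrightarrow> t \<in> {Horizontal, Vertical, Cross}"

fun allowed :: "row_type \<Rightarrow> tile set" where
  "allowed W_row = {Blank, Horizontal, Vertical, Cross, Elbow_WN, Elbow_SE, Double_WN_SE}"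
| "allowed E_row = {Blank, Horizontal, Vertical, Cross, Elbow_EN, Elbow_SW, Double_EN_SW}"

definition uses :: "tile \<Rightarrow> side \<Rightarrow> bool" where
  "uses t s \<longleftrightarrow> (\<exists>s'. (s, s') \<in> segments t \<or> (s', s) \<in> segments t)"

text \<open>
  Positions are in matrix coordinates: \<open>(i, j)\<close> is row \<open>i\<close> from the top and column \<open>j\<close> from
  the left. A filling is an extensional function on the grid, so that fillings are
  in bijection with functions on the set of grid positions.
\<close>

type_synonym filling = "nat \<times> nat \<Rightarrow> tile"

definition hybrid_generic :: "nat \<Rightarrow> nat \<Rightarrow> (nat \<Rightarrow> row_type) \<Rightarrow> filling set" where
  "hybrid_generic m n \<beta> =
    {D \<in> (\<Pi>\<^sub>E (i, j) \<in> {1..m} \<times> {1..n}. allowed (\<beta> i)).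
       (\<forall>i\<in>{1..m}. \<forall>j\<in>{1..<n}. uses (D (i, j)) East \<longleftrightarrow> uses (D (i, j + 1)) West) \<and>
       (\<forall>i\<in>{1..<m}. \<forall>j\<in>{1..n}. uses (D (i, j)) South \<longleftrightarrow> uses (D (i + 1, j)) North) \<and>
       (\<forall>i\<in>{1..m}. \<beta> i = W_row \<longrightarrow> uses (D (i, 1)) West \<and> \<not> uses (D (i, n)) East) \<and>
       (\<forall>i\<in>{1..m}. \<beta> i = E_row \<longrightarrow> uses (D (i, n)) East \<and> \<not> uses (D (i, 1)) West) \<and>
       (\<forall>j\<in>{1..n}. \<not> uses (D (m, j)) South)}"

text \<open>
  Unit edges of the grid: \<open>VEdge i j\<close> is the vertical edge of row \<open>i\<close> on the right of column \<open>j\<close>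
  (the left boundary of the grid if \<open>j = 0\<close>); \<open>HEdge i j\<close> is the horizontal edge of
  column \<open>j\<close> below row \<open>i\<close> (the top boundary of the grid if \<open>i = 0\<close>).
\<close>

datatype edge = VEdge nat nat | HEdge nat nat

fun edge_at :: "nat \<Rightarrow> nat \<Rightarrow> side \<Rightarrow> edge" where
  "edge_at i j West = VEdge i (j - 1)"
| "edge_at i j East = VEdge i j"
| "edge_at i j North = HEdge (i - 1) j"
| "edge_at i j South = HEdge i j"

definition joined :: "nat \<Rightarrow> nat \<Rightarrow> filling \<Rightarrow> (edge \<times> edge) set" where
  "joined m n D =
     {(edge_at i j s, edge_at i j s') | i j s s'. i \<in> {1..m} \<and> j \<in> {1..n} \<and>
        ((s, s') \<in> segments (D (i, j)) \<or> (s', s) \<in> segments (D (i, j)))}"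

definition entry_edge :: "nat \<Rightarrow> (nat \<Rightarrow> row_type) \<Rightarrow> nat \<Rightarrow> edge" where
  "entry_edge n \<beta> i = (case \<beta> i of W_row \<Rightarrow> VEdge i 0 | E_row \<Rightarrow> VEdge i n)"

text \<open>
  The set of edges traversed by the pipe entering row \<open>i\<close>. Since every edge is joined to at most
  one other edge on each of its two sides, no orientation of the pipes is needed.
\<close>

definition pipe :: "nat \<Rightarrow> nat \<Rightarrow> (nat \<Rightarrow> row_type) \<Rightarrow> filling \<Rightarrow> nat \<Rightarrow> edge set" where
  "pipe m n \<beta> D i = {e. (entry_edge n \<beta> i, e) \<in> (joined m n D)\<^sup>*}"

text \<open>The number of the pipe entering row \<open>i\<close>, counterclockwise from the northwest corner.\<close>

definition pipe_number :: "nat \<Rightarrow> (nat \<Rightarrow> row_type) \<Rightarrow> nat \<Rightarrow> nat" where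
  "pipe_number m \<beta> i =
     (case \<beta> i of
        W_row \<Rightarrow> card {r \<in> {1..i}. \<beta> r = W_row}
      | E_row \<Rightarrow> card {r \<in> {1..m}. \<beta> r = W_row} + card {r \<in> {i..m}. \<beta> r = E_row})"

definition has_connectivity ::
  "nat \<Rightarrow> nat \<Rightarrow> (nat \<Rightarrow> row_type) \<Rightarrow> filling \<Rightarrow> (nat \<Rightarrow> nat) \<Rightarrow> bool" where
  "has_connectivity m n \<beta> D \<pi> \<longleftrightarrow>
     (\<forall>i\<in>{1..m}. HEdge 0 (\<pi> (pipe_number m \<beta> i)) \<in> pipe m n \<beta> D i)"

definition generic_dreams ::
  "nat \<Rightarrow> nat \<Rightarrow> (nat \<Rightarrow> row_type) \<Rightarrow> (nat \<Rightarrow> nat) \<Rightarrow> filling set" where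
  "generic_dreams m n \<beta> \<pi> = {D \<in> hybrid_generic m n \<beta>. has_connectivity m n \<beta> D \<pi>}"

text \<open>The tiles where the pipes entering rows \<open>p\<close> and \<open>q\<close> cross each other.\<close>

definition crossings ::
  "nat \<Rightarrow> nat \<Rightarrow> (nat \<Rightarrow> row_type) \<Rightarrow> filling \<Rightarrow> nat \<Rightarrow> nat \<Rightarrow> (nat \<times> nat) set" where
  "crossings m n \<beta> D p q =
     {(i, j) \<in> {1..m} \<times> {1..n}. D (i, j) = Cross \<and>
        (edge_at i j West \<in> pipe m n \<beta> D p \<and> edge_at i j South \<in> pipe m n \<beta> D q \<or>
         edge_at i j West \<in> pipe m n \<beta> D q \<and> edge_at i j South \<in> pipe m n \<beta> D p)}"

definition nongeneric :: "nat \<Rightarrow> nat \<Rightarrow> (nat \<Rightarrow> row_type) \<Rightarrow> filling \<Rightarrow> bool" where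
  "nongeneric m n \<beta> D \<longleftrightarrow>
     (\<forall>i\<in>{1..m}. \<forall>j\<in>{1..n}.
        (\<beta> i = W_row \<longrightarrow> D (i, j) \<noteq> Vertical) \<and>
        (\<beta> i = E_row \<longrightarrow> D (i, j) \<noteq> Double_EN_SW)) \<and>
     (\<forall>p\<in>{1..m}. \<forall>q\<in>{1..m}. p \<noteq> q \<longrightarrow> card (crossings m n \<beta> D p q) \<le> 1)"

definition nongeneric_dreams ::
  "nat \<Rightarrow> nat \<Rightarrow> (nat \<Rightarrow> row_type) \<Rightarrow> (nat \<Rightarrow> nat) \<Rightarrow> filling set" where
  "nongeneric_dreams m n \<beta> \<pi> = {D \<in> generic_dreams m n \<beta> \<pi>. nongeneric m n \<beta> D}"

subsection \<open>Weights\<close>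

definition tile_weight :: "nat \<Rightarrow> (nat \<Rightarrow> row_type) \<Rightarrow> filling \<Rightarrow> nat \<Rightarrow> nat \<Rightarrow> poly" where
  "tile_weight m \<beta> D i j =
     (let x = X (pipe_number m \<beta> i); y = Y j in
      if D (i, j) = Blank then (case \<beta> i of W_row \<Rightarrow> B - x + y | E_row \<Rightarrow> A + x - y)
      else if straight (D (i, j)) then (case \<beta> i of W_row \<Rightarrow> A + x - y | E_row \<Rightarrow> B - x + y)
      else A + B)"

definition weight :: "nat \<Rightarrow> nat \<Rightarrow> (nat \<Rightarrow> row_type) \<Rightarrow> filling \<Rightarrow> poly" where
  "weight m n \<beta> D = (\<Prod>(i, j)\<in>{1..m} \<times> {1..n}. tile_weight m \<beta> D i j)"

definition G :: "nat \<Rightarrow> nat \<Rightarrow> (nat \<Rightarrow> row_type) \<Rightarrow> (nat \<Rightarrow> nat) \<Rightarrow> poly" where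
  "G m n \<beta> \<pi> = (\<Sum>D\<in>generic_dreams m n \<beta> \<pi>. weight m n \<beta> D)"

definition nongeneric_tile_weight ::
  "nat \<Rightarrow> (nat \<Rightarrow> row_type) \<Rightarrow> filling \<Rightarrow> nat \<Rightarrow> nat \<Rightarrow> poly" where
  "nongeneric_tile_weight m \<beta> D i j =
     (if \<beta> i = W_row \<and> straight (D (i, j)) \<or> \<beta> i = E_row \<and> D (i, j) = Blank
      then X (pipe_number m \<beta> i) - Y j else 1)"

definition nongeneric_weight :: "nat \<Rightarrow> nat \<Rightarrow> (nat \<Rightarrow> row_type) \<Rightarrow> filling \<Rightarrow> poly" where
  "nongeneric_weight m n \<beta> D =
     (\<Prod>(i, j)\<in>{1..m} \<times> {1..n}. nongeneric_tile_weight m \<beta> D i j)"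

definition S :: "nat \<Rightarrow> nat \<Rightarrow> (nat \<Rightarrow> row_type) \<Rightarrow> (nat \<Rightarrow> nat) \<Rightarrow> poly" where
  "S m n \<beta> \<pi> = (\<Sum>D\<in>nongeneric_dreams m n \<beta> \<pi>. nongeneric_weight m n \<beta> D)"

text \<open>The sums above range over finite sets.\<close>

lemma finite_generic_dreams: "finite (generic_dreams m n \<beta> \<pi>)"
proof -
  have fin: "finite (allowed b)" for b
    by (cases b) simp_all
  have "finite (\<Pi>\<^sub>E (i, j) \<in> {1..m} \<times> {1..n}. allowed (\<beta> i))"
    by (rule finite_PiE) (auto simp: fin)
  then show ?thesis
    by (rule rev_finite_subset) (auto simp: generic_dreams_def hybrid_generic_def)
qed

end

theory Submission
  imports Defs "HOL-Library.Disjoint_Sets"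
begin

text \<open>
  The power of \<open>B\<close> missing from the weight of a pipe dream is the number of straight tiles in
  \<open>W\<close> rows plus the number of blank tiles in \<open>E\<close> rows. Summing, over all rows, the columns
  where the pipes leave the row minus the columns where they enter it expresses this number as
  \<open>\<Sum>\<^sub>a \<pi> a - m (m + 1) / 2\<close> plus the number of cross tiles plus twice the number of vertical tiles in
  \<open>W\<close> rows plus the number of double elbows in \<open>E\<close> rows. On the other hand the number of inversions of
  the completion of \<open>\<pi>\<close> is \<open>\<Sum>\<^sub>a \<pi> a - m (m + 1) / 2\<close> plus the number of inversions of \<open>\<pi>\<close> itself. Two
  pipes cross an odd number of times iff they form an inversion of \<open>\<pi>\<close>, so the difference of the two
  quantities is a sum of nonnegative terms that all vanish exactly for the nongeneric pipe
  dreams. There is at least one of these, and no cancellation, because all of their contributions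
  evaluate to \<open>1\<close> at \<open>A = 0\<close>, \<open>B = 1\<close>, \<open>x = 1\<close>, \<open>y = 0\<close>.
\<close>

subsection \<open>Leading terms in \<open>B\<close> and substitution\<close>

text \<open>The set \<open>pipe\<close> is a transitive closure, on which order and counting
  arguments are awkward. Edge labels replace it by conditions on single tiles; once the two
  descriptions are known to agree, the top labels encode the connectivity and every count is made
  row by row. For a given dream the labels are found from the bottom upward, where no pipe is
  present; for the existence proof tiles and labels are built from the top downward, where
  \<open>\<pi>\<close> prescribes them.

  Pipes never descend, so the pipe entering row \<open>p\<close> stays in row \<open>p\<close> and
  the rows above. Pairs are therefore indexed by rows \<open>p < q\<close>: in row \<open>p\<close>
  the pipe of \<open>q\<close> is already present, and the pipe of \<open>p\<close> starts to its
  left or right according to \<open>\<beta> p\<close>. The same type decides which of the two has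
  the smaller pipe number, so it cancels and only inversions of \<open>\<pi>\<close> remain.\<close>

text \<open>The form \<open>q\<close> may be zero, and \<open>d\<close> is then merely a strict
  upper bound. This makes the relation compatible with sums, unlike \<open>B_leading_form\<close>,
  where top terms can cancel.\<close>

definition B_lead :: "nat \<Rightarrow> poly \<Rightarrow> poly \<Rightarrow> bool" where
  "B_lead d p q \<longleftrightarrow>
     (\<forall>t\<in>Poly_Mapping.keys q. Poly_Mapping.lookup t VB = d) \<and>
     (\<forall>t\<in>Poly_Mapping.keys (p - q). Poly_Mapping.lookup t VB < d)"

lemma keys_mult_VB:
  fixes p q :: poly
  assumes "t \<in> Poly_Mapping.keys (p * q)"
  obtains a b where "a \<in> Poly_Mapping.keys p" "b \<in> Poly_Mapping.keys q"
    "Poly_Mapping.lookup t VB = Poly_Mapping.lookup a VB + Poly_Mapping.lookup b VB"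
proof -
  from assms obtain a b where "t = a + b" "a \<in> Poly_Mapping.keys p" "b \<in> Poly_Mapping.keys q"
    using keys_mult[of p q] by blast
  then show thesis using that[of a b] by (simp add: lookup_add)
qed

lemma B_lead_mult:
  assumes "B_lead d p q" "B_lead d' p' q'"
  shows "B_lead (d + d') (p * p') (q * q')"
proof -
  define r r' where "r = p - q" and "r' = p' - q'"
  have q: "\<And>t. t \<in> Poly_Mapping.keys q \<Longrightarrow> Poly_Mapping.lookup t VB = d"
    and r: "\<And>t. t \<in> Poly_Mapping.keys r \<Longrightarrow> Poly_Mapping.lookup t VB < d"
    and q': "\<And>t. t \<in> Poly_Mapping.keys q' \<Longrightarrow> Poly_Mapping.lookup t VB = d'"
    and r': "\<And>t. t \<in> Poly_Mapping.keys r' \<Longrightarrow> Poly_Mapping.lookup t VB < d'"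
    using assms by (auto simp: B_lead_def r_def r'_def)
  have eq: "p * p' - q * q' = q * r' + r * q' + r * r'"
    by (simp add: r_def r'_def algebra_simps)
  show ?thesis
    unfolding B_lead_def eq
  proof (intro conjI ballI)
    fix t assume "t \<in> Poly_Mapping.keys (q * q')"
    then show "Poly_Mapping.lookup t VB = d + d'"
      by (rule keys_mult_VB) (simp add: q q')
  next
    fix t assume "t \<in> Poly_Mapping.keys (q * r' + r * q' + r * r')"
    then have "t \<in> Poly_Mapping.keys (q * r') \<or> t \<in> Poly_Mapping.keys (r * q') \<or>
        t \<in> Poly_Mapping.keys (r * r')"
      using Poly_Mapping.keys_add[of "q * r' + r * q'" "r * r'"]
        Poly_Mapping.keys_add[of "q * r'" "r * q'"] by blast
    then show "Poly_Mapping.lookup t VB < d + d'"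
    proof (elim disjE)
      assume "t \<in> Poly_Mapping.keys (q * r')"
      then show ?thesis by (rule keys_mult_VB) (simp add: q r')
    next
      assume "t \<in> Poly_Mapping.keys (r * q')"
      then show ?thesis by (rule keys_mult_VB) (simp add: r q')
    next
      assume "t \<in> Poly_Mapping.keys (r * r')"
      then show ?thesis by (rule keys_mult_VB) (simp add: add_strict_mono r r')
    qed
  qed
qed

lemma B_lead_prod:
  assumes "finite I" "\<And>i. i \<in> I \<Longrightarrow> B_lead (d i) (p i) (q i)"
  shows "B_lead (\<Sum>i\<in>I. d i) (\<Prod>i\<in>I. p i) (\<Prod>i\<in>I. q i)"
  using assms
proof (induction I rule: finite_induct)
  case empty
  then show ?case by (simp add: B_lead_def flip: single_one)
next
  case (insert x F)
  then show ?case by (simp add: B_lead_mult)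
qed

lemma B_lead_add:
  assumes "B_lead d p q" "B_lead d p' q'"
  shows "B_lead d (p + p') (q + q')"
proof -
  have eq: "p + p' - (q + q') = (p - q) + (p' - q')" by simp
  show ?thesis
    unfolding B_lead_def eq
  proof (intro conjI ballI)
    fix t assume "t \<in> Poly_Mapping.keys (q + q')"
    then have "t \<in> Poly_Mapping.keys q \<or> t \<in> Poly_Mapping.keys q'"
      using Poly_Mapping.keys_add[of q q'] by blast
    then show "Poly_Mapping.lookup t VB = d" using assms by (auto simp: B_lead_def)
  next
    fix t assume "t \<in> Poly_Mapping.keys ((p - q) + (p' - q'))"
    then have "t \<in> Poly_Mapping.keys (p - q) \<or> t \<in> Poly_Mapping.keys (p' - q')"
      using Poly_Mapping.keys_add[of "p - q" "p' - q'"] by blast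
    then show "Poly_Mapping.lookup t VB < d" using assms by (auto simp: B_lead_def)
  qed
qed

lemma B_lead_sum:
  assumes "finite I" "\<And>i. i \<in> I \<Longrightarrow> B_lead d (p i) (q i)"
  shows "B_lead d (\<Sum>i\<in>I. p i) (\<Sum>i\<in>I. q i)"
  using assms
proof (induction I rule: finite_induct)
  case empty
  then show ?case by (simp add: B_lead_def)
next
  case (insert x F)
  then show ?case by (simp add: B_lead_add)
qed

text \<open>Absorbs lower-degree summands, both inside the weight of a tile and for the dreams that
  do not contribute.\<close>

lemma B_lead_zero:
  assumes "B_lead d p q" "d < d'"
  shows "B_lead d' p 0"
proof -
  have "Poly_Mapping.keys p \<subseteq> Poly_Mapping.keys q \<union> Poly_Mapping.keys (p - q)"
    using Poly_Mapping.keys_add[of q "p - q"] by simp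
  then show ?thesis using assms unfolding B_lead_def by fastforce
qed

lemma lookup_B_lead:
  assumes "B_lead d p q"
  shows "Poly_Mapping.lookup q t = (if Poly_Mapping.lookup t VB = d then Poly_Mapping.lookup p t else 0)"
proof -
  have "Poly_Mapping.lookup (p - q) t = 0" if "Poly_Mapping.lookup t VB = d"
    using assms that by (force simp: B_lead_def in_keys_iff)
  moreover have "Poly_Mapping.lookup q t = 0" if "Poly_Mapping.lookup t VB \<noteq> d"
    using assms that by (force simp: B_lead_def in_keys_iff)
  ultimately show ?thesis by (auto simp: lookup_minus)
qed

lemma keys_B_lead_le:
  assumes "B_lead d p q" "t \<in> Poly_Mapping.keys p"
  shows "Poly_Mapping.lookup t VB \<le> d"
proof -
  have "t \<in> Poly_Mapping.keys q \<union> Poly_Mapping.keys (p - q)"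
    using Poly_Mapping.keys_add[of q "p - q"] assms(2) by auto
  then show ?thesis using assms(1) unfolding B_lead_def by auto
qed

lemma B_degree_le:
  assumes "B_lead d p q"
  shows "B_degree p \<le> d"
  unfolding B_degree_def using keys_B_lead_le[OF assms] by auto

lemma B_degree_eq:
  assumes "B_lead d p q" "q \<noteq> 0"
  shows "B_degree p = d"
proof -
  obtain t where t: "t \<in> Poly_Mapping.keys q" using assms(2) by fastforce
  then have d: "Poly_Mapping.lookup t VB = d" and "t \<in> Poly_Mapping.keys p"
    using lookup_B_lead[OF assms(1), of t] by (auto simp: in_keys_iff split: if_splits)
  then have "d \<in> insert 0 ((\<lambda>t. Poly_Mapping.lookup t VB) ` Poly_Mapping.keys p)" by blast
  then have "d \<le> B_degree p" unfolding B_degree_def by (intro Max_ge) auto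
  with B_degree_le[OF assms(1)] show ?thesis by simp
qed

text \<open>A nonzero \<open>q\<close> guarantees that the degree \<open>d\<close> is attained;
  otherwise the leading form could sit in a lower degree.\<close>

lemma B_leading_form_eq:
  assumes "B_lead d p q" "q \<noteq> 0"
  shows "B_leading_form p = q"
proof (rule poly_mapping_eqI)
  fix t
  have "Poly_Mapping.lookup (B_leading_form p) t =
    (\<Sum>s\<in>{t \<in> Poly_Mapping.keys p. Poly_Mapping.lookup t VB = d}.
       Poly_Mapping.lookup p s when s = t)"
    unfolding B_leading_form_def B_degree_eq[OF assms]
    by (simp add: lookup_sum lookup_single)
  also have "\<dots> = Poly_Mapping.lookup q t"
    by (simp add: lookup_B_lead[OF assms(1)] when_def in_keys_iff)
  finally show "Poly_Mapping.lookup (B_leading_form p) t = Poly_Mapping.lookup q t" .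
qed

section \<open>Substitution as a ring homomorphism\<close>

definition power_product :: "(var \<Rightarrow> poly) \<Rightarrow> monom \<Rightarrow> poly" where
  "power_product f t = (\<Prod>v\<in>Poly_Mapping.keys t. f v ^ Poly_Mapping.lookup t v)"

lemma power_product_superset:
  assumes "finite K" "Poly_Mapping.keys t \<subseteq> K"
  shows "power_product f t = (\<Prod>v\<in>K. f v ^ Poly_Mapping.lookup t v)"
  unfolding power_product_def using assms
  by (intro prod.mono_neutral_left) (auto simp: in_keys_iff)

lemma power_product_add: "power_product f (s + t) = power_product f s * power_product f t"
proof -
  let ?K = "Poly_Mapping.keys s \<union> Poly_Mapping.keys t"
  have "Poly_Mapping.keys (s + t) \<subseteq> ?K" by (rule Poly_Mapping.keys_add)
  then have "power_product f (s + t) = (\<Prod>v\<in>?K. f v ^ Poly_Mapping.lookup (s + t) v)"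
    by (intro power_product_superset) auto
  also have "\<dots> = (\<Prod>v\<in>?K. f v ^ Poly_Mapping.lookup s v) * (\<Prod>v\<in>?K. f v ^ Poly_Mapping.lookup t v)"
    by (simp only: lookup_add power_add prod.distrib)
  also have "\<dots> = power_product f s * power_product f t"
    by (intro arg_cong2[of _ _ _ _ "(*)"] power_product_superset[symmetric]) auto
  finally show ?thesis .
qed

text \<open>Enlarging the index set brings two polynomials to a common support, on which additivity
  is termwise.\<close>

lemma substitute_superset:
  assumes "finite K" "Poly_Mapping.keys p \<subseteq> K"
  shows "substitute f p = (\<Sum>t\<in>K. of_int (Poly_Mapping.lookup p t) * power_product f t)"
  unfolding substitute_def power_product_def[symmetric] using assms
  by (intro sum.mono_neutral_left) (auto simp: in_keys_iff)

lemma substitute_add: "substitute f (p + q) = substitute f p + substitute f q"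
proof -
  let ?K = "Poly_Mapping.keys p \<union> Poly_Mapping.keys q"
  have "Poly_Mapping.keys (p + q) \<subseteq> ?K" by (rule Poly_Mapping.keys_add)
  then have "substitute f (p + q) =
      (\<Sum>t\<in>?K. of_int (Poly_Mapping.lookup (p + q) t) * power_product f t)"
    by (intro substitute_superset) auto
  also have "\<dots> = (\<Sum>t\<in>?K. of_int (Poly_Mapping.lookup p t) * power_product f t) +
      (\<Sum>t\<in>?K. of_int (Poly_Mapping.lookup q t) * power_product f t)"
    by (simp only: lookup_add of_int_add distrib_right sum.distrib)
  also have "\<dots> = substitute f p + substitute f q"
    by (intro arg_cong2[of _ _ _ _ "(+)"] substitute_superset[symmetric]) auto
  finally show ?thesis .
qed

lemma substitute_zero: "substitute f 0 = 0"
  by (simp add: substitute_def)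

lemma substitute_sum: "substitute f (\<Sum>i\<in>I. p i) = (\<Sum>i\<in>I. substitute f (p i))"
  by (induction I rule: infinite_finite_induct) (simp_all add: substitute_zero substitute_add)

lemma substitute_single:
  "substitute f (Poly_Mapping.single t c) = of_int c * power_product f t"
  by (subst substitute_superset[of "{t}"]) auto

lemma substitute_diff: "substitute f (p - q) = substitute f p - substitute f q"
  using substitute_add[of f "p - q" q] by simp

lemma poly_eq_sum_single:
  "p = (\<Sum>t\<in>Poly_Mapping.keys p. Poly_Mapping.single t (Poly_Mapping.lookup p t))"
  for p :: poly
  by (rule poly_mapping_eqI)
    (simp add: lookup_sum lookup_single when_def in_keys_iff)

lemma substitute_mult: "substitute f (p * q) = substitute f p * substitute f q"
proof -
  let ?s = "\<lambda>p t. Poly_Mapping.single t (Poly_Mapping.lookup p t) :: poly"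
  have "p * q = (\<Sum>s\<in>Poly_Mapping.keys p. \<Sum>t\<in>Poly_Mapping.keys q. ?s p s * ?s q t)"
    by (subst (1) poly_eq_sum_single[of p], subst (1) poly_eq_sum_single[of q])
      (simp add: sum_product)
  then have "substitute f (p * q) =
    (\<Sum>s\<in>Poly_Mapping.keys p. \<Sum>t\<in>Poly_Mapping.keys q. substitute f (?s p s) * substitute f (?s q t))"
    by (simp add: substitute_sum mult_single substitute_single power_product_add algebra_simps)
  also have "\<dots> = substitute f (\<Sum>s\<in>Poly_Mapping.keys p. ?s p s) *
      substitute f (\<Sum>t\<in>Poly_Mapping.keys q. ?s q t)"
    by (simp add: sum_product substitute_sum)
  finally show ?thesis by (simp flip: poly_eq_sum_single)
qed

lemma substitute_one: "substitute f 1 = 1"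
  using substitute_single[of f 0 1] by (simp add: power_product_def)

lemma substitute_Var: "substitute f (Var v) = f v"
  by (simp add: Var_def substitute_single power_product_def)

lemma substitute_prod: "substitute f (\<Prod>i\<in>I. p i) = (\<Prod>i\<in>I. substitute f (p i))"
  by (induction I rule: infinite_finite_induct) (simp_all add: substitute_one substitute_mult)

lemma substitute_power: "substitute f (p ^ k) = substitute f p ^ k"
  by (induction k) (simp_all add: substitute_one substitute_mult)

subsection \<open>Edge labels\<close>

text \<open>
  A used edge is labelled by the row where its pipe enters, an unused edge by \<open>0\<close>. Within a row, \<open>v j\<close>
  is the label of the vertical edge to the right of column \<open>j\<close>, and \<open>g j\<close>, \<open>f j\<close> are the labels above
  and below column \<open>j\<close>.
\<close>

fun side_label :: "(nat \<Rightarrow> nat) \<Rightarrow> (nat \<Rightarrow> nat) \<Rightarrow> (nat \<Rightarrow> nat) \<Rightarrow> nat \<Rightarrow> side \<Rightarrow> nat" where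
  "side_label v g f j West = v (j - 1)"
| "side_label v g f j East = v j"
| "side_label v g f j North = g j"
| "side_label v g f j South = f j"

definition row_labelled ::
  "nat \<Rightarrow> row_type \<Rightarrow> nat \<Rightarrow> (nat \<Rightarrow> tile) \<Rightarrow> (nat \<Rightarrow> nat) \<Rightarrow> (nat \<Rightarrow> nat) \<Rightarrow> (nat \<Rightarrow> nat) \<Rightarrow> bool" where
  "row_labelled n b i T v g f \<longleftrightarrow>
     (case b of W_row \<Rightarrow> v 0 = i \<and> v n = 0 | E_row \<Rightarrow> v n = i \<and> v 0 = 0) \<and>
     (\<forall>j\<in>{1..n}. T j \<in> allowed b \<and>
        (\<forall>(s, s')\<in>segments (T j). side_label v g f j s = side_label v g f j s') \<and>
        (\<forall>s. uses (T j) s \<longleftrightarrow> side_label v g f j s \<noteq> 0))"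

definition labelling ::
  "nat \<Rightarrow> nat \<Rightarrow> (nat \<Rightarrow> row_type) \<Rightarrow> filling \<Rightarrow> (nat \<Rightarrow> nat \<Rightarrow> nat) \<Rightarrow> (nat \<Rightarrow> nat \<Rightarrow> nat) \<Rightarrow> bool" where
  "labelling m n \<beta> D H V \<longleftrightarrow> (\<forall>j\<in>{1..n}. H m j = 0) \<and>
     (\<forall>i\<in>{1..m}. row_labelled n (\<beta> i) i (\<lambda>j. D (i, j)) (V i) (H (i - 1)) (H i))"

lemma all_side: "(\<forall>s. P s) \<longleftrightarrow> P North \<and> P East \<and> P South \<and> P West"
  by (metis side.exhaust)

lemma uses_iff:
  "uses t North \<longleftrightarrow> t \<in> {Vertical, Cross, Elbow_WN, Double_WN_SE, Elbow_EN, Double_EN_SW}"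
  "uses t East \<longleftrightarrow> t \<in> {Horizontal, Cross, Elbow_SE, Double_WN_SE, Elbow_EN, Double_EN_SW}"
  "uses t South \<longleftrightarrow> t \<in> {Vertical, Cross, Elbow_SE, Double_WN_SE, Elbow_SW, Double_EN_SW}"
  "uses t West \<longleftrightarrow> t \<in> {Horizontal, Cross, Elbow_WN, Double_WN_SE, Elbow_SW, Double_EN_SW}"
  by (cases t; simp add: uses_def)+

lemma W_row_tile_labels:
  "T \<in> allowed W_row \<and> (\<forall>(s, s')\<in>segments T. side_label v g f j s = side_label v g f j s') \<and>
     (\<forall>s. uses T s \<longleftrightarrow> side_label v g f j s \<noteq> 0) \<longleftrightarrow>
   T \<in> allowed W_row \<and> (\<forall>s. uses T s \<longleftrightarrow> side_label v g f j s \<noteq> 0) \<and>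
     (if T = Blank \<or> straight T then v j = v (j - 1) \<and> g j = f j
      else v j = f j \<and> g j = v (j - 1))"
  by (cases T; simp add: all_side uses_iff straight_def; metis)

lemma E_row_tile_labels:
  "T \<in> allowed E_row \<and> (\<forall>(s, s')\<in>segments T. side_label v g f j s = side_label v g f j s') \<and>
     (\<forall>s. uses T s \<longleftrightarrow> side_label v g f j s \<noteq> 0) \<longleftrightarrow>
   T \<in> allowed E_row \<and> (\<forall>s. uses T s \<longleftrightarrow> side_label v g f j s \<noteq> 0) \<and>
     (if T = Blank \<or> straight T then v j = v (j - 1) \<and> f j = g j
      else v j = g j \<and> f j = v (j - 1))"
  by (cases T; simp add: all_side uses_iff straight_def; metis)

lemma row_labelled_W:
  "row_labelled n W_row i T v g f \<longleftrightarrow> v 0 = i \<and> v n = 0 \<and>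
     (\<forall>j\<in>{1..n}. T j \<in> allowed W_row \<and> (\<forall>s. uses (T j) s \<longleftrightarrow> side_label v g f j s \<noteq> 0) \<and>
       (if T j = Blank \<or> straight (T j) then v j = v (j - 1) \<and> g j = f j
        else v j = f j \<and> g j = v (j - 1)))"
  unfolding row_labelled_def W_row_tile_labels by simp

lemma row_labelled_E:
  "row_labelled n E_row i T v g f \<longleftrightarrow> v 0 = 0 \<and> v n = i \<and>
     (\<forall>j\<in>{1..n}. T j \<in> allowed E_row \<and> (\<forall>s. uses (T j) s \<longleftrightarrow> side_label v g f j s \<noteq> 0) \<and>
       (if T j = Blank \<or> straight (T j) then v j = v (j - 1) \<and> f j = g j
        else v j = g j \<and> f j = v (j - 1)))"
  unfolding row_labelled_def E_row_tile_labels by auto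

lemma W_row_uses:
  assumes "T \<in> allowed W_row"
  shows "if T = Blank \<or> straight T then (uses T East = uses T West \<and> uses T North = uses T South)
    else (uses T East = uses T South \<and> uses T North = uses T West)"
  using assms by (cases T; simp add: uses_iff straight_def)

lemma E_row_uses:
  assumes "T \<in> allowed E_row"
  shows "if T = Blank \<or> straight T then (uses T East = uses T West \<and> uses T North = uses T South)
    else (uses T West = uses T South \<and> uses T North = uses T East)"
  using assms by (cases T; simp add: uses_iff straight_def)

text \<open>Pipes in a \<open>W\<close> row travel East, so the carried label is computed by
  recursion over the columns, starting at the entry; the labels above are then read off.\<close>

lemma ex_row_labelled_W:
  assumes "1 \<le> n" "i > 0"
    and T: "\<And>j. j \<in> {1..n} \<Longrightarrow> T j \<in> allowed W_row"
    and EW: "\<And>j. j \<in> {1..<n} \<Longrightarrow> uses (T j) East \<longleftrightarrow> uses (T (j + 1)) West"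
    and W: "uses (T 1) West" and E: "\<not> uses (T n) East"
    and f: "\<And>j. j \<in> {1..n} \<Longrightarrow> uses (T j) South \<longleftrightarrow> f j \<noteq> 0"
  shows "\<exists>v g. row_labelled n W_row i T v g f"
proof -
  define v where "v = rec_nat i (\<lambda>j x. if T (Suc j) = Blank \<or> straight (T (Suc j)) then x else f (Suc j))"
  define g where "g j = (if T j = Blank \<or> straight (T j) then f j else v (j - 1))" for j
  have v0: "v 0 = i" and vS: "v (Suc j) = (if T (Suc j) = Blank \<or> straight (T (Suc j)) then v j else f (Suc j))" for j
    by (simp_all add: v_def)
  have West: "uses (T (Suc j)) West \<longleftrightarrow> v j \<noteq> 0" if "j < n" for j
    using that
  proof (induction j)
    case 0
    then show ?case using W v0 assms(2) by simp
  next
    case (Suc j)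
    have "uses (T (Suc (Suc j))) West \<longleftrightarrow> uses (T (Suc j)) East"
      using EW[of "Suc j"] Suc.prems by simp
    also have "\<dots> \<longleftrightarrow> v (Suc j) \<noteq> 0"
      using W_row_uses[OF T[of "Suc j"]] f[of "Suc j"] Suc by (auto simp: vS split: if_splits)
    finally show ?case .
  qed
  have uses: "(uses (T j) East \<longleftrightarrow> v j \<noteq> 0) \<and> (uses (T j) West \<longleftrightarrow> v (j - 1) \<noteq> 0) \<and>
      (uses (T j) South \<longleftrightarrow> f j \<noteq> 0) \<and> (uses (T j) North \<longleftrightarrow> g j \<noteq> 0)" if j: "j \<in> {1..n}" for j
  proof -
    obtain k where k: "j = Suc k" "k < n" using j by (cases j) auto
    show ?thesis
      using W_row_uses[OF T[OF j]] West[OF k(2)] f[OF j] k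
      by (auto simp: vS g_def split: if_splits)
  qed
  have "v n = 0" using uses[of n] E assms(1) by simp
  moreover have "T j \<in> allowed W_row \<and> (\<forall>s. uses (T j) s \<longleftrightarrow> side_label v g f j s \<noteq> 0) \<and>
       (if T j = Blank \<or> straight (T j) then v j = v (j - 1) \<and> g j = f j
        else v j = f j \<and> g j = v (j - 1))" if j: "j \<in> {1..n}" for j
  proof (intro conjI T[OF j])
    show "\<forall>s. uses (T j) s \<longleftrightarrow> side_label v g f j s \<noteq> 0"
      using uses[OF j] unfolding all_side by simp
    obtain k where "j = Suc k" using j by (cases j) auto
    then show "if T j = Blank \<or> straight (T j) then v j = v (j - 1) \<and> g j = f j
        else v j = f j \<and> g j = v (j - 1)"
      by (simp add: g_def vS)
  qed
  ultimately have "row_labelled n W_row i T v g f"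
    using v0 unfolding row_labelled_W by blast
  then show ?thesis by blast
qed

text \<open>Pipes travel West here, so the recursion \<open>w\<close> runs over the distance from
  the East boundary.\<close>

lemma ex_row_labelled_E:
  assumes "1 \<le> n" "i > 0"
    and T: "\<And>j. j \<in> {1..n} \<Longrightarrow> T j \<in> allowed E_row"
    and EW: "\<And>j. j \<in> {1..<n} \<Longrightarrow> uses (T j) East \<longleftrightarrow> uses (T (j + 1)) West"
    and W: "\<not> uses (T 1) West" and E: "uses (T n) East"
    and f: "\<And>j. j \<in> {1..n} \<Longrightarrow> uses (T j) South \<longleftrightarrow> f j \<noteq> 0"
  shows "\<exists>v g. row_labelled n E_row i T v g f"
proof -
  define w where "w = rec_nat i (\<lambda>t x. if T (n - t) = Blank \<or> straight (T (n - t)) then x else f (n - t))"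
  define v where "v j = w (n - j)" for j
  define g where "g j = (if T j = Blank \<or> straight (T j) then f j else v j)" for j
  have vn: "v n = i" by (simp add: v_def w_def)
  have v: "v (j - 1) = (if T j = Blank \<or> straight (T j) then v j else f j)" if "j \<in> {1..n}" for j
  proof -
    have "n - (j - 1) = Suc (n - j)" "n - (n - j) = j" using that by auto
    then show ?thesis by (simp add: v_def w_def)
  qed
  have East: "uses (T j) East \<longleftrightarrow> v j \<noteq> 0" if "1 \<le> j" "j \<le> n" for j
    using that(2,1)
  proof (induction j rule: inc_induct)
    case base
    then show ?case using E vn assms(2) by simp
  next
    case (step j)
    have "uses (T j) East \<longleftrightarrow> uses (T (Suc j)) West"
      using EW[of j] step.hyps step.prems by simp
    also have "\<dots> \<longleftrightarrow> v j \<noteq> 0"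
      using E_row_uses[OF T[of "Suc j"]] f[of "Suc j"] step v[of "Suc j"] by (auto split: if_splits)
    finally show ?case .
  qed
  have uses: "(uses (T j) East \<longleftrightarrow> v j \<noteq> 0) \<and> (uses (T j) West \<longleftrightarrow> v (j - 1) \<noteq> 0) \<and>
      (uses (T j) South \<longleftrightarrow> f j \<noteq> 0) \<and> (uses (T j) North \<longleftrightarrow> g j \<noteq> 0)" if "j \<in> {1..n}" for j
    using E_row_uses[OF T[OF that]] East[of j] f[OF that] v[OF that] that
    by (auto simp: g_def split: if_splits)
  have "v 0 = 0" using uses[of 1] W assms(1) by simp
  moreover have "T j \<in> allowed E_row \<and> (\<forall>s. uses (T j) s \<longleftrightarrow> side_label v g f j s \<noteq> 0) \<and>
       (if T j = Blank \<or> straight (T j) then v j = v (j - 1) \<and> f j = g j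
        else v j = g j \<and> f j = v (j - 1))" if j: "j \<in> {1..n}" for j
  proof (intro conjI T[OF j])
    show "\<forall>s. uses (T j) s \<longleftrightarrow> side_label v g f j s \<noteq> 0"
      using uses[OF j] unfolding all_side by simp
    show "if T j = Blank \<or> straight (T j) then v j = v (j - 1) \<and> f j = g j
        else v j = g j \<and> f j = v (j - 1)"
      using v[OF j] by (simp add: g_def)
  qed
  ultimately have "row_labelled n E_row i T v g f"
    using vn unfolding row_labelled_E by blast
  then show ?thesis by blast
qed

text \<open>Rows are labelled from the bottom; the labels obtained above one row serve as the labels
  below the next.\<close>

lemma ex_labelling:
  assumes "1 \<le> n" and D: "D \<in> hybrid_generic m n \<beta>"
  shows "\<exists>H V. labelling m n \<beta> D H V"
proof -
  have allowed: "\<And>i j. i \<in> {1..m} \<Longrightarrow> j \<in> {1..n} \<Longrightarrow> D (i, j) \<in> allowed (\<beta> i)"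
    and EW: "\<And>i j. i \<in> {1..m} \<Longrightarrow> j \<in> {1..<n} \<Longrightarrow> uses (D (i, j)) East \<longleftrightarrow> uses (D (i, j + 1)) West"
    and SN: "\<And>i j. i \<in> {1..<m} \<Longrightarrow> j \<in> {1..n} \<Longrightarrow> uses (D (i, j)) South \<longleftrightarrow> uses (D (i + 1, j)) North"
    and bW: "\<And>i. i \<in> {1..m} \<Longrightarrow> \<beta> i = W_row \<Longrightarrow> uses (D (i, 1)) West \<and> \<not> uses (D (i, n)) East"
    and bE: "\<And>i. i \<in> {1..m} \<Longrightarrow> \<beta> i = E_row \<Longrightarrow> uses (D (i, n)) East \<and> \<not> uses (D (i, 1)) West"
    and bS: "\<And>j. j \<in> {1..n} \<Longrightarrow> \<not> uses (D (m, j)) South"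
    using D unfolding hybrid_generic_def PiE_iff by auto
  have row: "\<exists>v g. row_labelled n (\<beta> i) i (\<lambda>j. D (i, j)) v g f"
    if "i \<in> {1..m}" and "\<And>j. j \<in> {1..n} \<Longrightarrow> uses (D (i, j)) South \<longleftrightarrow> f j \<noteq> 0" for i f
  proof (cases "\<beta> i")
    case W_row
    then show ?thesis
      using ex_row_labelled_W[of n i "\<lambda>j. D (i, j)" f] that assms(1) allowed[of i] EW[of i] bW[of i]
      by auto
  next
    case E_row
    then show ?thesis
      using ex_row_labelled_E[of n i "\<lambda>j. D (i, j)" f] that assms(1) allowed[of i] EW[of i] bE[of i]
      by auto
  qed
  have "\<exists>H V. (\<forall>j\<in>{1..n}. H m j = 0) \<and>
      (\<forall>i\<in>{k<..m}. row_labelled n (\<beta> i) i (\<lambda>j. D (i, j)) (V i) (H (i - 1)) (H i))" if "k \<le> m" for k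
    using that
  proof (induction k rule: inc_induct)
    case base
    show ?case by (intro exI[of _ "\<lambda>_ _. 0"]) simp
  next
    case (step k)
    then obtain H V where H: "\<forall>j\<in>{1..n}. H m j = 0"
      and rows: "\<And>i. i \<in> {Suc k<..m} \<Longrightarrow> row_labelled n (\<beta> i) i (\<lambda>j. D (i, j)) (V i) (H (i - 1)) (H i)"
      by blast
    \<comment> \<open>Used South sides of this row are used North sides of the row beneath, where
      the labels are already nonzero exactly at used sides.\<close>
    have "uses (D (Suc k, j)) South \<longleftrightarrow> H (Suc k) j \<noteq> 0" if "j \<in> {1..n}" for j
    proof (cases "Suc k = m")
      case True
      then show ?thesis using H bS that by simp
    next
      case False
      then have "uses (D (Suc (Suc k), j)) North \<longleftrightarrow> H (Suc k) j \<noteq> 0"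
        using rows[of "Suc (Suc k)"] that step.hyps unfolding row_labelled_def all_side by auto
      then show ?thesis using SN[of "Suc k" j] that False step.hyps by simp
    qed
    then obtain v g where vg: "row_labelled n (\<beta> (Suc k)) (Suc k) (\<lambda>j. D (Suc k, j)) v g (H (Suc k))"
      using row[of "Suc k" "H (Suc k)"] step.hyps by auto
    have "row_labelled n (\<beta> i) i (\<lambda>j. D (i, j)) ((V(Suc k := v)) i) ((H(k := g)) (i - 1)) ((H(k := g)) i)"
      if "i \<in> {k<..m}" for i
      using that vg rows[of i] by (cases "i = Suc k") auto
    then show ?case
      using H step.hyps by (intro exI[of _ "H(k := g)"] exI[of _ "V(Suc k := v)"]) auto
  qed
  moreover have "{0<..m} = {1..m}" by auto
  ultimately show ?thesis
    unfolding labelling_def by (metis zero_le)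
qed

subsection \<open>A single row\<close>

text \<open>
  Scan a row from West to East. A straight or blank tile exchanges two adjacent letters \<open>v (j - 1), f j\<close>
  of the word \<open>v 0, f 1, \<dots>, f n\<close>, an elbow tile keeps them, and the scan ends in the word
  \<open>g 1, \<dots>, g n, v n\<close>. In an \<open>E\<close> row the same holds with \<open>f\<close> and \<open>g\<close> interchanged.
\<close>

definition exchange ::
  "nat \<Rightarrow> (nat \<Rightarrow> bool) \<Rightarrow> (nat \<Rightarrow> nat) \<Rightarrow> (nat \<Rightarrow> nat) \<Rightarrow> (nat \<Rightarrow> nat) \<Rightarrow> bool" where
  "exchange n st v f g \<longleftrightarrow>
     (\<forall>j\<in>{1..n}. if st j then v j = v (j - 1) \<and> g j = f j else v j = f j \<and> g j = v (j - 1))"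

definition plain :: "tile \<Rightarrow> bool" where
  "plain t \<longleftrightarrow> t = Blank \<or> straight t"

lemma row_labelled_W_exchange:
  "row_labelled n W_row i T v g f \<Longrightarrow> exchange n (\<lambda>j. plain (T j)) v f g"
  by (auto simp: row_labelled_W exchange_def plain_def)

text \<open>Elbows of an \<open>E\<close> row join West with South and East with North. The eastward
  scan thus runs against the direction of travel: it consumes the labels above and produces those
  below.\<close>

lemma row_labelled_E_exchange:
  "row_labelled n E_row i T v g f \<Longrightarrow> exchange n (\<lambda>j. plain (T j)) v g f"
  by (auto simp: row_labelled_E exchange_def plain_def)

lemma exchange_SucD:
  "exchange (Suc n) st v f g \<Longrightarrow> exchange n st v f g \<and>
    (if st (Suc n) then v (Suc n) = v n \<and> g (Suc n) = f (Suc n)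
     else v (Suc n) = f (Suc n) \<and> g (Suc n) = v n)"
  by (auto simp: exchange_def)

lemma exchange_mono: "exchange n st v f g \<Longrightarrow> k \<le> n \<Longrightarrow> exchange k st v f g"
  by (auto simp: exchange_def)

text \<open>The scan only rearranges the letters of the word, so multiplicities are
  preserved.\<close>

lemma exchange_count:
  assumes "exchange n st v f g"
  shows "card {j\<in>{1..n}. g j = x} + of_bool (v n = x) = card {j\<in>{1..n}. f j = x} + of_bool (v 0 = x)"
  using assms
proof (induction n)
  case 0
  then show ?case by simp
next
  case (Suc n)
  have *: "card {j\<in>{1..Suc n}. h j = x} = card {j\<in>{1..n}. h j = x} + of_bool (h (Suc n) = x)" for h
  proof -
    have "{j\<in>{1..Suc n}. h j = x} =
        (if h (Suc n) = x then insert (Suc n) {j\<in>{1..n}. h j = x} else {j\<in>{1..n}. h j = x})"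
      by (auto simp: le_Suc_eq)
    then show ?thesis by simp
  qed
  from Suc show ?case
    unfolding * using exchange_SucD[OF Suc.prems] by (auto split: if_splits)
qed

lemma exchange_carry:
  assumes "exchange n st v f g" "j \<le> n"
  shows "v j = v 0 \<or> (\<exists>u\<in>{1..n}. v j = f u)"
  using assms(2)
proof (induction j)
  case (Suc j)
  then show ?case
    using assms(1) Suc.prems unfolding exchange_def
    by (metis Suc_leD atLeastAtMost_iff diff_Suc_1 le_add1 plus_1_eq_Suc)
qed simp

section \<open>Relative order of two letters during the scan\<close>

definition occurs_only_at :: "nat set \<Rightarrow> (nat \<Rightarrow> nat) \<Rightarrow> nat \<Rightarrow> nat \<Rightarrow> bool" where
  "occurs_only_at I w p a \<longleftrightarrow> a \<in> I \<and> (\<forall>s\<in>I. w s = p \<longleftrightarrow> s = a)"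

lemma occurs_only_at_unique: "occurs_only_at I w p a \<Longrightarrow> occurs_only_at I w p b \<Longrightarrow> a = b"
  by (auto simp: occurs_only_at_def)

text \<open>The state of the scan after column \<open>j\<close>, at positions \<open>0..n\<close>:
  finished letters, the carried letter, letters still to come. With \<open>g\<close> written one
  position to the left, an elbow leaves the word unchanged and a plain tile swaps two
  neighbours.\<close>

definition cut_word :: "(nat \<Rightarrow> nat) \<Rightarrow> (nat \<Rightarrow> nat) \<Rightarrow> (nat \<Rightarrow> nat) \<Rightarrow> nat \<Rightarrow> nat \<Rightarrow> nat" where
  "cut_word v f g j s = (if s < j then g (Suc s) else if s = j then v j else f s)"

definition meetings ::
  "nat \<Rightarrow> (nat \<Rightarrow> bool) \<Rightarrow> (nat \<Rightarrow> nat) \<Rightarrow> (nat \<Rightarrow> nat) \<Rightarrow> nat \<Rightarrow> nat \<Rightarrow> nat set" where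
  "meetings n st v f p q =
     {j\<in>{1..n}. st j \<and> (v (j - 1) = p \<and> f j = q \<or> v (j - 1) = q \<and> f j = p)}"

text \<open>A swap of neighbours reverses the order of \<open>p\<close> and \<open>q\<close> exactly
  when these are the two letters swapped, so only the parity of the number of meetings
  matters.\<close>

lemma exchange_order_aux:
  assumes ex: "exchange n st v f g" and "p \<noteq> q"
    and P0: "occurs_only_at {..n} (cut_word v f g 0) p P0"
    and Q0: "occurs_only_at {..n} (cut_word v f g 0) q Q0"
    and "j \<le> n"
  shows "\<exists>P Q. occurs_only_at {..n} (cut_word v f g j) p P \<and> occurs_only_at {..n} (cut_word v f g j) q Q \<and>
    (P < Q \<longleftrightarrow> (P0 < Q0 \<longleftrightarrow> even (card (meetings j st v f p q))))"
  using \<open>j \<le> n\<close>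
proof (induction j)
  case 0
  then show ?case using P0 Q0 by (auto simp: meetings_def)
next
  case (Suc j)
  then obtain P Q where P: "occurs_only_at {..n} (cut_word v f g j) p P"
    and Q: "occurs_only_at {..n} (cut_word v f g j) q Q"
    and less: "P < Q \<longleftrightarrow> (P0 < Q0 \<longleftrightarrow> even (card (meetings j st v f p q)))" by auto
  have PQ: "P \<noteq> Q" using P Q \<open>p \<noteq> q\<close> by (auto simp: occurs_only_at_def)
  have step: "if st (Suc j) then v (Suc j) = v j \<and> g (Suc j) = f (Suc j)
     else v (Suc j) = f (Suc j) \<and> g (Suc j) = v j"
    using ex Suc.prems by (auto simp: exchange_def dest!: bspec[of _ _ "Suc j"])
  have meet: "meetings (Suc j) st v f p q =
      (if st (Suc j) \<and> (v j = p \<and> f (Suc j) = q \<or> v j = q \<and> f (Suc j) = p)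
       then insert (Suc j) (meetings j st v f p q) else meetings j st v f p q)"
    by (auto simp: meetings_def le_Suc_eq)
  have "Suc j \<notin> meetings j st v f p q" "finite (meetings j st v f p q)"
    by (auto simp: meetings_def)
  note card_meet = this
  show ?case
  proof (cases "st (Suc j)")
    case False
    then have "cut_word v f g (Suc j) = cut_word v f g j"
      using step by (auto simp: cut_word_def fun_eq_iff less_Suc_eq)
    then show ?thesis using P Q less False by (auto simp: meet)
  next
    case True
    \<comment> \<open>The transposition of positions by which the cut word changes in this
      column.\<close>
    define sw where "sw s = (if s = j then Suc j else if s = Suc j then j else s)" for s
    have sw: "cut_word v f g (Suc j) s = cut_word v f g j (sw s)" for s
      using step True by (auto simp: cut_word_def sw_def less_Suc_eq)
    have swsw: "sw s = t \<longleftrightarrow> s = sw t" for s t by (auto simp: sw_def)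
    have sw_le: "sw s \<le> n \<longleftrightarrow> s \<le> n" for s using Suc.prems by (auto simp: sw_def)
    have P': "occurs_only_at {..n} (cut_word v f g (Suc j)) p (sw P)"
      and Q': "occurs_only_at {..n} (cut_word v f g (Suc j)) q (sw Q)"
      using P Q by (auto simp: occurs_only_at_def sw swsw sw_le)
    \<comment> \<open>The swapped letters are \<open>p\<close> and \<open>q\<close>
      themselves.\<close>
    define c where "c \<longleftrightarrow> j = P \<and> Suc j = Q \<or> j = Q \<and> Suc j = P"
    have "v j = cut_word v f g j j" "f (Suc j) = cut_word v f g j (Suc j)"
      by (simp_all add: cut_word_def)
    then have "v j = p \<longleftrightarrow> j = P" "f (Suc j) = p \<longleftrightarrow> Suc j = P" "v j = q \<longleftrightarrow> j = Q" "f (Suc j) = q \<longleftrightarrow> Suc j = Q"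
      using P Q Suc.prems by (auto simp: occurs_only_at_def)
    then have "card (meetings (Suc j) st v f p q) = card (meetings j st v f p q) +
        of_bool c"
      using True card_meet by (simp add: meet c_def)
    moreover have "sw P < sw Q \<longleftrightarrow> (P < Q \<longleftrightarrow> \<not> c)"
      using PQ by (auto simp: sw_def c_def)
    ultimately have "sw P < sw Q \<longleftrightarrow> (P0 < Q0 \<longleftrightarrow> even (card (meetings (Suc j) st v f p q)))"
      using less by (cases c) simp_all
    then show ?thesis using P' Q' by blast
  qed
qed

lemma exchange_order:
  assumes "exchange n st v f g" "p \<noteq> q"
    and "occurs_only_at {..n} (cut_word v f g 0) p P0" "occurs_only_at {..n} (cut_word v f g 0) q Q0"
    and "occurs_only_at {..n} (cut_word v f g n) p P" "occurs_only_at {..n} (cut_word v f g n) q Q"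
  shows "P < Q \<longleftrightarrow> (P0 < Q0 \<longleftrightarrow> even (card (meetings n st v f p q)))"
  using exchange_order_aux[OF assms(1-4), of n] occurs_only_at_unique assms(5,6) by (metis order_refl)

lemma cut_word_start:
  assumes "occurs_only_at {1..n} f p a" "v 0 \<noteq> p"
  shows "occurs_only_at {..n} (cut_word v f g 0) p a"
  using assms by (auto simp: occurs_only_at_def cut_word_def)

text \<open>The final word lists \<open>g 1, ..., g n\<close> from position 0 on, hence the shift by
  one.\<close>

lemma cut_word_end:
  assumes "occurs_only_at {1..n} g p a" "v n \<noteq> p"
  shows "occurs_only_at {..n} (cut_word v f g n) p (a - 1)"
  using assms by (fastforce simp: occurs_only_at_def cut_word_def)

definition row_crossings ::
  "nat \<Rightarrow> (nat \<Rightarrow> tile) \<Rightarrow> (nat \<Rightarrow> nat) \<Rightarrow> (nat \<Rightarrow> nat) \<Rightarrow> nat \<Rightarrow> nat \<Rightarrow> nat set" where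
  "row_crossings n T v f p q = meetings n (\<lambda>j. T j = Cross) v f p q"

text \<open>A plain tile whose West and South sides are both used can only be a cross, so meetings
  of nonzero letters are crossings.\<close>

lemma row_crossings_W:
  assumes "row_labelled n W_row i T v g f" "p \<noteq> 0" "q \<noteq> 0"
  shows "row_crossings n T v f p q = meetings n (\<lambda>j. plain (T j)) v f p q"
proof -
  have "T j = Cross \<longleftrightarrow> plain (T j)" if j: "j \<in> {1..n}" and "v (j - 1) \<noteq> 0" "f j \<noteq> 0" for j
  proof -
    have "uses (T j) West" "uses (T j) South" "T j \<in> allowed W_row"
      using assms(1) that by (simp_all add: row_labelled_W)
    then show ?thesis
      by (cases "T j") (simp_all add: plain_def straight_def uses_iff)
  qed
  then show ?thesis using assms(2,3) unfolding row_crossings_def meetings_def by auto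
qed

text \<open>The scan refers to the labels above the row and \<open>row_crossings\<close> to those
  below; at a cross tile the two agree.\<close>

lemma row_crossings_E:
  assumes "row_labelled n E_row i T v g f" "p \<noteq> 0" "q \<noteq> 0"
  shows "row_crossings n T v f p q = meetings n (\<lambda>j. plain (T j)) v g p q"
proof -
  have *: "T j = Cross \<longleftrightarrow> plain (T j)" if "j \<in> {1..n}" "v (j - 1) \<noteq> 0" "g j \<noteq> 0" for j
  proof -
    have "uses (T j) West" "uses (T j) North" "T j \<in> allowed E_row"
      using assms(1) that by (simp_all add: row_labelled_E)
    then show ?thesis
      by (cases "T j") (simp_all add: plain_def straight_def uses_iff)
  qed
  have **: "f j = g j" if "j \<in> {1..n}" "T j = Cross" for j
    using assms(1) that by (simp add: row_labelled_E straight_def)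
  show ?thesis
    using assms(2,3) * ** unfolding row_crossings_def meetings_def by (intro Collect_cong) auto
qed

lemma row_order:
  assumes row: "row_labelled n b i T v g f" and pq: "p \<noteq> q" "p \<noteq> 0" "q \<noteq> 0" "p \<noteq> i" "q \<noteq> i"
    and f: "occurs_only_at {1..n} f p a" "occurs_only_at {1..n} f q b'"
    and g: "occurs_only_at {1..n} g p c" "occurs_only_at {1..n} g q d"
  shows "c < d \<longleftrightarrow> (a < b' \<longleftrightarrow> even (card (row_crossings n T v f p q)))"
proof (cases b)
  case W_row
  then have row: "row_labelled n W_row i T v g f" using row by simp
  then have v: "v 0 = i" "v n = 0" by (auto simp: row_labelled_W)
  have "c - 1 < d - 1 \<longleftrightarrow> (a < b' \<longleftrightarrow> even (card (row_crossings n T v f p q)))"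
    unfolding row_crossings_W[OF row pq(2,3)] using v pq
    by (intro exchange_order[OF row_labelled_W_exchange[OF row] pq(1)] cut_word_start cut_word_end f g) auto
  moreover have "c - 1 < d - 1 \<longleftrightarrow> c < d" using g by (auto simp: occurs_only_at_def)
  ultimately show ?thesis by simp
next
  case E_row
  then have row: "row_labelled n E_row i T v g f" using row by simp
  then have v: "v n = i" "v 0 = 0" by (auto simp: row_labelled_E)
  \<comment> \<open>The scan leads from the order above the row to the order below it; a parity
    relation can be read in either direction.\<close>
  have "a - 1 < b' - 1 \<longleftrightarrow> (c < d \<longleftrightarrow> even (card (row_crossings n T v f p q)))"
    unfolding row_crossings_E[OF row pq(2,3)] using v pq
    by (intro exchange_order[OF row_labelled_E_exchange[OF row] pq(1)] cut_word_start cut_word_end f g) auto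
  moreover have "a - 1 < b' - 1 \<longleftrightarrow> a < b'" using f by (auto simp: occurs_only_at_def)
  ultimately show ?thesis by auto
qed

text \<open>The entering pipe starts at the left end of the word in a \<open>W\<close> row and at
  the right end in an \<open>E\<close> row, so the row type takes the place of the order below the
  row.\<close>

lemma row_order_entering:
  assumes row: "row_labelled n b i T v g f" and pq: "p \<noteq> q" "p \<noteq> 0" "q \<noteq> 0" "p = i"
    and f: "p \<notin> f ` {1..n}" "occurs_only_at {1..n} f q b'"
    and g: "occurs_only_at {1..n} g p c" "occurs_only_at {1..n} g q d"
  shows "c < d \<longleftrightarrow> (b = W_row \<longleftrightarrow> even (card (row_crossings n T v f p q)))"
proof -
  have fp: "f s \<noteq> p" if "1 \<le> s" "s \<le> n" for s using f(1) that by auto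
  show ?thesis
  proof (cases b)
    case W_row
    then have row: "row_labelled n W_row i T v g f" using row by simp
    then have v: "v 0 = i" "v n = 0" by (auto simp: row_labelled_W)
    have p: "occurs_only_at {..n} (cut_word v f g 0) p 0"
      using fp v pq by (auto simp: occurs_only_at_def cut_word_def)
    have "c - 1 < d - 1 \<longleftrightarrow> (0 < b' \<longleftrightarrow> even (card (row_crossings n T v f p q)))"
      unfolding row_crossings_W[OF row pq(2,3)] using v pq
      by (intro exchange_order[OF row_labelled_W_exchange[OF row] pq(1)] cut_word_start cut_word_end f(2) g p) auto
    moreover have "c - 1 < d - 1 \<longleftrightarrow> c < d" using g by (auto simp: occurs_only_at_def)
    moreover have "0 < b'" using f(2) by (auto simp: occurs_only_at_def)
    ultimately show ?thesis using W_row by simp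
  next
    case E_row
    then have row: "row_labelled n E_row i T v g f" using row by simp
    then have v: "v n = i" "v 0 = 0" by (auto simp: row_labelled_E)
    have p: "occurs_only_at {..n} (cut_word v g f n) p n"
      using fp v pq by (auto simp: occurs_only_at_def cut_word_def)
    \<comment> \<open>The entering label stands at position \<open>n\<close> at the end of the scan,
      beyond every possible \<open>b' - 1\<close>, so the left side is false.\<close>
    have "n < b' - 1 \<longleftrightarrow> (c < d \<longleftrightarrow> even (card (row_crossings n T v f p q)))"
      unfolding row_crossings_E[OF row pq(2,3)] using v pq
      by (intro exchange_order[OF row_labelled_E_exchange[OF row] pq(1)] cut_word_start cut_word_end f(2) g p) auto
    moreover have "\<not> n < b' - 1" using f(2) by (auto simp: occurs_only_at_def)
    ultimately show ?thesis using E_row by auto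
  qed
qed

lemma row_labelled_count:
  assumes "row_labelled n b i T v g f" "x \<noteq> 0"
  shows "card {j\<in>{1..n}. g j = x} = card {j\<in>{1..n}. f j = x} + of_bool (x = i)"
proof (cases b)
  case W_row
  then have row: "row_labelled n W_row i T v g f" using assms by simp
  show ?thesis
    using exchange_count[OF row_labelled_W_exchange[OF row], of x] row assms(2)
    by (auto simp: row_labelled_W split: if_splits)
next
  case E_row
  then have row: "row_labelled n E_row i T v g f" using assms by simp
  show ?thesis
    using exchange_count[OF row_labelled_E_exchange[OF row], of x] row assms(2)
    by (auto simp: row_labelled_E split: if_splits)
qed

lemma row_labelled_carry:
  assumes "row_labelled n b i T v g f" "j \<le> n" "v j \<noteq> 0"
  shows "v j = i \<or> v j \<in> f ` {1..n} \<or> v j \<in> g ` {1..n}"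
proof (cases b)
  case W_row
  then have row: "row_labelled n W_row i T v g f" using assms by simp
  show ?thesis
    using exchange_carry[OF row_labelled_W_exchange[OF row] assms(2)] row
    by (auto simp: row_labelled_W)
next
  case E_row
  then have row: "row_labelled n E_row i T v g f" using assms by simp
  show ?thesis
    using exchange_carry[OF row_labelled_E_exchange[OF row] assms(2)] row assms(3)
    by (auto simp: row_labelled_E)
qed

text \<open>If the two swapped letters were equal, this letter would occur twice among the letters
  handled up to column \<open>j\<close>, hence twice in the initial word, because the scan preserves
  multiplicities.\<close>

lemma exchange_distinct:
  assumes "exchange n st v f g" "j \<in> {1..n}" "st j"
    and "card {u\<in>{1..n}. f u = v (j - 1)} + of_bool (v 0 = v (j - 1)) \<le> 1"
  shows "v (j - 1) \<noteq> f j"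
proof
  assume eq: "v (j - 1) = f j"
  define x where "x = v (j - 1)"
  have *: "v j = x" "g j = x" "f j = x" using assms(1-3) eq by (auto simp: exchange_def x_def)
  have "0 < card {u\<in>{1..j}. g u = x}"
    using * assms(2) by (auto simp: card_gt_0_iff)
  moreover have "card {u\<in>{1..j}. g u = x} + of_bool (v j = x) = card {u\<in>{1..j}. f u = x} + of_bool (v 0 = x)"
    using exchange_count[OF exchange_mono[OF assms(1)], of j] assms(2) by simp
  moreover have "card {u\<in>{1..j}. f u = x} \<le> card {u\<in>{1..n}. f u = x}"
    using assms(2) by (intro card_mono) auto
  ultimately show False using assms(4) * by (simp add: x_def)
qed

subsection \<open>Pipes and their crossings\<close>

fun edge_label :: "(nat \<Rightarrow> nat \<Rightarrow> nat) \<Rightarrow> (nat \<Rightarrow> nat \<Rightarrow> nat) \<Rightarrow> edge \<Rightarrow> nat" where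
  "edge_label H V (VEdge i j) = V i j"
| "edge_label H V (HEdge i j) = H i j"

text \<open>Serves two purposes: a given dream with the labels found for it, and the filling built
  in the existence proof, whose membership in \<open>hybrid_generic\<close> is derived from its
  labels.\<close>

locale labelled_filling =
  fixes m n :: nat and \<beta> :: "nat \<Rightarrow> row_type" and D :: filling and H V :: "nat \<Rightarrow> nat \<Rightarrow> nat"
  assumes n_pos: "1 \<le> n" and labelling: "labelling m n \<beta> D H V"
begin

lemma row: "i \<in> {1..m} \<Longrightarrow> row_labelled n (\<beta> i) i (\<lambda>j. D (i, j)) (V i) (H (i - 1)) (H i)"
  and bottom: "j \<in> {1..n} \<Longrightarrow> H m j = 0"
  using labelling by (simp_all add: labelling_def)

lemma side_label_edge: "side_label (V i) (H (i - 1)) (H i) j s = edge_label H V (edge_at i j s)"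
  by (cases s) simp_all

lemma tile:
  assumes "i \<in> {1..m}" "j \<in> {1..n}"
  shows "D (i, j) \<in> allowed (\<beta> i)"
    and "(s, s') \<in> segments (D (i, j)) \<Longrightarrow> edge_label H V (edge_at i j s) = edge_label H V (edge_at i j s')"
    and "uses (D (i, j)) s \<longleftrightarrow> edge_label H V (edge_at i j s) \<noteq> 0"
  using row[OF assms(1)] assms(2) unfolding row_labelled_def side_label_edge by fastforce+

text \<open>Going up, row \<open>i\<close> adds one occurrence of the label \<open>i\<close> and
  keeps the multiplicity of every other nonzero label; below the last row there are none.\<close>

lemma level_count:
  assumes "k \<le> m" "x \<noteq> 0"
  shows "card {j\<in>{1..n}. H k j = x} = of_bool (k < x \<and> x \<le> m)"
  using assms(1)
proof (induction k rule: inc_induct)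
  case base
  have "{j\<in>{1..n}. H m j = x} = {}" using bottom assms(2) by auto
  then show ?case by auto
next
  case (step k)
  then show ?case
    using row_labelled_count[OF row[of "Suc k"] assms(2)] by (auto simp: Suc_le_eq)
qed

lemma level_column:
  assumes "k < x" "x \<le> m"
  obtains a where "occurs_only_at {1..n} (H k) x a"
proof -
  have "card {j\<in>{1..n}. H k j = x} = 1" using level_count[of k x] assms by simp
  then obtain a where "{j\<in>{1..n}. H k j = x} = {a}" by (meson card_1_singletonE)
  then have "occurs_only_at {1..n} (H k) x a" unfolding occurs_only_at_def by blast
  then show thesis by (rule that)
qed

lemma level_range:
  assumes "k \<le> m" "j \<in> {1..n}" "H k j \<noteq> 0"
  shows "k < H k j" "H k j \<le> m"
proof -
  have "j \<in> {j'\<in>{1..n}. H k j' = H k j}" using assms(2) by simp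
  then have "card {j'\<in>{1..n}. H k j' = H k j} \<noteq> 0" by (subst card_0_eq) (simp, blast)
  then have "k < H k j \<and> H k j \<le> m"
    unfolding level_count[OF assms(1,3)] of_bool_eq_0_iff by blast
  then show "k < H k j" "H k j \<le> m" by simp_all
qed

lemma carry_range:
  assumes "i \<in> {1..m}" "j \<le> n" "V i j \<noteq> 0"
  shows "i \<le> V i j" "V i j \<le> m"
proof -
  have "V i j = i \<or> V i j \<in> H i ` {1..n} \<or> V i j \<in> H (i - 1) ` {1..n}"
    by (rule row_labelled_carry[OF row[OF assms(1)] assms(2,3)])
  then have "i \<le> V i j \<and> V i j \<le> m"
  proof (elim disjE imageE)
    fix u assume u: "V i j = H i u" "u \<in> {1..n}"
    then show ?thesis using level_range[of i u] assms by simp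
  next
    fix u assume u: "V i j = H (i - 1) u" "u \<in> {1..n}"
    moreover have "i - 1 \<le> m" "i = Suc (i - 1)" using assms(1) by auto
    ultimately show ?thesis using level_range[of "i - 1" u] assms(3) by (metis Suc_leI)
  qed (use assms in auto)
  then show "i \<le> V i j" "V i j \<le> m" by simp_all
qed

section \<open>Label classes are the pipes\<close>

lemma entry_label: "i \<in> {1..m} \<Longrightarrow> edge_label H V (entry_edge n \<beta> i) = i"
  using row[of i] by (cases "\<beta> i") (simp_all add: row_labelled_def entry_edge_def)

lemma pipe_label:
  assumes "e \<in> pipe m n \<beta> D i" "i \<in> {1..m}"
  shows "edge_label H V e = i"
proof -
  have "(entry_edge n \<beta> i, e) \<in> (joined m n D)\<^sup>*" using assms by (simp add: pipe_def)
  then show ?thesis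
  proof induction
    case base
    then show ?case by (rule entry_label[OF assms(2)])
  next
    case (step y z)
    then show ?case using tile(2) by (fastforce simp: joined_def)
  qed
qed

lemma segment_pipe:
  assumes "i \<in> {1..m}" "j \<in> {1..n}" "(s, s') \<in> segments (D (i, j))"
  shows "edge_at i j s \<in> pipe m n \<beta> D p \<longleftrightarrow> edge_at i j s' \<in> pipe m n \<beta> D p"
proof -
  have "(edge_at i j s, edge_at i j s') \<in> joined m n D" "(edge_at i j s', edge_at i j s) \<in> joined m n D"
    using assms unfolding joined_def by blast+
  then show ?thesis unfolding pipe_def by (auto intro: rtrancl_into_rtrancl)
qed

text \<open>The converse of \<open>pipe_label\<close> follows the direction of travel: a vertical
  edge is reached from the previous vertical edge or from below, where the claim is already
  known.\<close>

lemma pipe_row_W: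
  assumes i: "i \<in> {1..m}" "\<beta> i = W_row"
    and below: "\<And>j. j \<in> {1..n} \<Longrightarrow> H i j \<noteq> 0 \<Longrightarrow> HEdge i j \<in> pipe m n \<beta> D (H i j)"
    and "j \<le> n" "V i j \<noteq> 0"
  shows "VEdge i j \<in> pipe m n \<beta> D (V i j)"
  using assms(4,5)
proof (induction j)
  case 0
  then show ?case using row[OF i(1)] i(2) by (simp add: row_labelled_def pipe_def entry_edge_def)
next
  case (Suc j)
  then have j: "Suc j \<in> {1..n}" by simp
  have u: "uses (D (i, Suc j)) East" using Suc.prems tile(3)[OF i(1) j, of East] by simp
  have a: "D (i, Suc j) \<in> allowed W_row" using tile(1)[OF i(1) j] i(2) by simp
  consider "(West, East) \<in> segments (D (i, Suc j))" | "(South, East) \<in> segments (D (i, Suc j))"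
    using u a by (cases "D (i, Suc j)") (auto simp: uses_iff)
  then show ?case
  proof cases
    case 1
    then show ?thesis
      using Suc tile(2)[OF i(1) j 1] segment_pipe[OF i(1) j 1] by simp
  next
    case 2
    then show ?thesis
      using Suc.prems tile(2)[OF i(1) j 2] segment_pipe[OF i(1) j 2] below[OF j] by simp
  qed
qed

lemma pipe_row_E:
  assumes i: "i \<in> {1..m}" "\<beta> i = E_row"
    and below: "\<And>j. j \<in> {1..n} \<Longrightarrow> H i j \<noteq> 0 \<Longrightarrow> HEdge i j \<in> pipe m n \<beta> D (H i j)"
    and "j \<le> n" "V i j \<noteq> 0"
  shows "VEdge i j \<in> pipe m n \<beta> D (V i j)"
  using assms(4,5)
proof (induction j rule: inc_induct)
  case base
  then show ?case using row[OF i(1)] i(2) by (simp add: row_labelled_def pipe_def entry_edge_def)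
next
  case (step j)
  then have j: "Suc j \<in> {1..n}" by simp
  have u: "uses (D (i, Suc j)) West" using step.prems tile(3)[OF i(1) j, of West] by simp
  have a: "D (i, Suc j) \<in> allowed E_row" using tile(1)[OF i(1) j] i(2) by simp
  consider "(West, East) \<in> segments (D (i, Suc j))" | "(South, West) \<in> segments (D (i, Suc j))"
    using u a by (cases "D (i, Suc j)") (auto simp: uses_iff)
  then show ?case
  proof cases
    case 1
    then show ?thesis
      using step tile(2)[OF i(1) j 1] segment_pipe[OF i(1) j 1] by simp
  next
    case 2
    then show ?thesis
      using step.prems tile(2)[OF i(1) j 2] segment_pipe[OF i(1) j 2] below[OF j] by simp
  qed
qed

lemma pipe_row:
  assumes i: "i \<in> {1..m}"
    and below: "\<And>j. j \<in> {1..n} \<Longrightarrow> H i j \<noteq> 0 \<Longrightarrow> HEdge i j \<in> pipe m n \<beta> D (H i j)"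
    and "j \<le> n" "V i j \<noteq> 0"
  shows "VEdge i j \<in> pipe m n \<beta> D (V i j)"
  using assms pipe_row_W pipe_row_E by (cases "\<beta> i") blast+

lemma HEdge_pipe:
  assumes "k \<le> m" "j \<in> {1..n}" "H k j \<noteq> 0"
  shows "HEdge k j \<in> pipe m n \<beta> D (H k j)"
  using assms
proof (induction k arbitrary: j rule: inc_induct)
  case base
  then show ?case using bottom by simp
next
  case (step k)
  define i where "i = Suc k"
  have i: "i \<in> {1..m}" and k: "k = i - 1" using step.hyps by (auto simp: i_def)
  have below: "\<And>j. j \<in> {1..n} \<Longrightarrow> H i j \<noteq> 0 \<Longrightarrow> HEdge i j \<in> pipe m n \<beta> D (H i j)"
    using step.IH by (simp add: i_def)
  have u: "uses (D (i, j)) North" using step.prems tile(3)[OF i step.prems(1), of North] by (simp add: k)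
  \<comment> \<open>The segment at the top edge starts on a side for which the claim is settled: the
    edge below or a vertical edge of this row.\<close>
  obtain s where s: "s \<in> {West, East, South}"
    "(s, North) \<in> segments (D (i, j)) \<or> (North, s) \<in> segments (D (i, j))"
    using u by (cases "D (i, j)") (auto simp: uses_iff)
  have l: "edge_label H V (edge_at i j s) = H k j"
    using s(2) tile(2)[OF i step.prems(1), of s North] tile(2)[OF i step.prems(1), of North s] by (auto simp: k)
  have "edge_at i j s \<in> pipe m n \<beta> D (H k j)"
    using s(1) l step.prems below[of j] pipe_row[OF i below, of j] pipe_row[OF i below, of "j - 1"]
    by auto
  then have "edge_at i j North \<in> pipe m n \<beta> D (H k j)"
    using s(2) segment_pipe[OF i step.prems(1)] by blast
  then show ?case by (simp add: k)
qed

lemma HEdge_pipe_iff: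
  assumes "k \<le> m" "j \<in> {1..n}" "p \<in> {1..m}"
  shows "HEdge k j \<in> pipe m n \<beta> D p \<longleftrightarrow> H k j = p"
  using HEdge_pipe[OF assms(1,2)] pipe_label[OF _ assms(3), of "HEdge k j"] assms(3) by auto

lemma VEdge_pipe_iff:
  assumes "i \<in> {1..m}" "j \<le> n" "p \<in> {1..m}"
  shows "VEdge i j \<in> pipe m n \<beta> D p \<longleftrightarrow> V i j = p"
  using pipe_row[OF assms(1) HEdge_pipe assms(2)] pipe_label[OF _ assms(3), of "VEdge i j"] assms(1,3) by auto

section \<open>Parity and number of crossings\<close>

lemma crossings_eq:
  assumes "p \<in> {1..m}" "q \<in> {1..m}"
  shows "crossings m n \<beta> D p q = (SIGMA i:{1..m}. row_crossings n (\<lambda>j. D (i, j)) (V i) (H i) p q)"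
proof -
  have "edge_at i j West \<in> pipe m n \<beta> D x \<longleftrightarrow> V i (j - 1) = x"
    "edge_at i j South \<in> pipe m n \<beta> D x \<longleftrightarrow> H i j = x"
    if "i \<in> {1..m}" "j \<in> {1..n}" "x \<in> {1..m}" for i j x
    using VEdge_pipe_iff[OF that(1) _ that(3), of "j - 1"] HEdge_pipe_iff[OF _ that(2,3), of i] that(1,2)
    by (auto simp: le_diff_conv)
  then show ?thesis
    using assms unfolding crossings_def row_crossings_def meetings_def by blast
qed

lemma row_crossings_below_entry:
  assumes "p < i" "i \<le> m"
  shows "row_crossings n (\<lambda>j. D (i, j)) (V i) (H i) p q = {}"
proof -
  have "V i (j - 1) \<noteq> p \<or> p = 0" "H i j \<noteq> p \<or> p = 0" if "j \<in> {1..n}" for j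
    using that assms carry_range[of i "j - 1"] level_range[of i j] by fastforce+
  moreover have "j \<notin> row_crossings n (\<lambda>j. D (i, j)) (V i) (H i) 0 q" if "j \<in> {1..n}" for j
    using that tile(3)[of i j West] tile(3)[of i j South] assms
    by (auto simp: row_crossings_def meetings_def uses_iff)
  ultimately show ?thesis by (cases "p = 0") (fastforce simp: row_crossings_def meetings_def)+
qed

text \<open>Upward induction from row \<open>p\<close>, where pipe \<open>p\<close> enters while
  pipe \<open>q\<close> is already present; each further row flips the order according to the parity
  of its crossings.\<close>

lemma level_order:
  assumes pq: "0 < p" "p < q" "q \<le> m" and "k \<le> p - 1"
    and "occurs_only_at {1..n} (H k) p a" "occurs_only_at {1..n} (H k) q b"
  shows "a < b \<longleftrightarrow> (\<beta> p = W_row \<longleftrightarrow>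
    even (\<Sum>i\<in>{k<..p}. card (row_crossings n (\<lambda>j. D (i, j)) (V i) (H i) p q)))"
  using assms(4-6)
proof (induction k arbitrary: a b rule: inc_induct)
  case base
  obtain b' where b': "occurs_only_at {1..n} (H p) q b'" using level_column[of p q] pq by auto
  have "p \<notin> H p ` {1..n}" using level_range(1)[of p] pq by fastforce
  moreover have "{p - 1<..p} = {p}" using pq by auto
  ultimately show ?case
    using row_order_entering[OF row, of p p q b' a b] base pq b' by simp
next
  case (step k)
  define i where "i = Suc k"
  have i: "i \<in> {1..m}" "k = i - 1" using step.hyps pq by (auto simp: i_def)
  have "i < p" using step.hyps pq by (simp add: i_def)
  then obtain a' where a': "occurs_only_at {1..n} (H i) p a'" using level_column[of i p] pq by auto
  obtain b' where b': "occurs_only_at {1..n} (H i) q b'" using level_column[of i q] \<open>i < p\<close> pq by auto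
  have IH: "a' < b' \<longleftrightarrow> (\<beta> p = W_row \<longleftrightarrow>
    even (\<Sum>i\<in>{i<..p}. card (row_crossings n (\<lambda>j. D (i, j)) (V i) (H i) p q)))"
    using step.IH a' b' by (simp add: i_def)
  have "a < b \<longleftrightarrow> (a' < b' \<longleftrightarrow> even (card (row_crossings n (\<lambda>j. D (i, j)) (V i) (H i) p q)))"
    using step.prems pq \<open>i < p\<close> by (intro row_order[OF row[OF i(1)] _ _ _ _ _ a' b']) (simp_all add: i_def)
  moreover have "{k<..p} = insert i {i<..p}" using step.hyps pq by (auto simp: i_def)
  then have "(\<Sum>i\<in>{k<..p}. card (row_crossings n (\<lambda>j. D (i, j)) (V i) (H i) p q)) =
     card (row_crossings n (\<lambda>j. D (i, j)) (V i) (H i) p q) +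
     (\<Sum>i\<in>{i<..p}. card (row_crossings n (\<lambda>j. D (i, j)) (V i) (H i) p q))"
    by simp
  ultimately show ?case using IH by (simp add: even_add) blast
qed

lemma card_crossings:
  assumes "0 < p" "p < q" "q \<le> m"
  shows "card (crossings m n \<beta> D p q) =
    (\<Sum>i\<in>{0<..p}. card (row_crossings n (\<lambda>j. D (i, j)) (V i) (H i) p q))"
proof -
  have fin: "finite (row_crossings n (\<lambda>j. D (i, j)) (V i) (H i) p q)" for i
    by (simp add: row_crossings_def meetings_def)
  have "card (crossings m n \<beta> D p q) =
    (\<Sum>i\<in>{1..m}. card (row_crossings n (\<lambda>j. D (i, j)) (V i) (H i) p q))"
    using assms fin by (subst crossings_eq) (auto simp: card_SigmaI)
  also have "\<dots> = (\<Sum>i\<in>{0<..p}. card (row_crossings n (\<lambda>j. D (i, j)) (V i) (H i) p q))"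
    using assms by (intro sum.mono_neutral_right) (auto simp: row_crossings_below_entry)
  finally show ?thesis .
qed

lemma crossings_parity:
  assumes "0 < p" "p < q" "q \<le> m"
    and "occurs_only_at {1..n} (H 0) p a" "occurs_only_at {1..n} (H 0) q b"
  shows "a < b \<longleftrightarrow> (\<beta> p = W_row \<longleftrightarrow> even (card (crossings m n \<beta> D p q)))"
  using level_order[of p q 0 a b] assms by (simp add: card_crossings)

text \<open>Each nonzero label occurs at most once in the word scanned by a row, so no pipe meets
  itself. Hence every cross tile belongs to a genuine pair of pipes.\<close>

lemma Cross_distinct:
  assumes "i \<in> {1..m}" "j \<in> {1..n}" "D (i, j) = Cross"
  shows "V i (j - 1) \<noteq> H i j" "V i (j - 1) \<noteq> 0" "H i j \<noteq> 0"
proof -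
  show nz: "V i (j - 1) \<noteq> 0" "H i j \<noteq> 0"
    using tile(3)[OF assms(1,2), of West] tile(3)[OF assms(1,2), of South] assms(3)
    by (simp_all add: uses_iff)
  show "V i (j - 1) \<noteq> H i j"
  proof (cases "\<beta> i")
    case W_row
    then have r: "row_labelled n W_row i (\<lambda>j. D (i, j)) (V i) (H (i - 1)) (H i)"
      using row[OF assms(1)] by simp
    show ?thesis
      using level_count[of i "V i (j - 1)"] nz r assms
      by (intro exchange_distinct[OF row_labelled_W_exchange[OF r] assms(2)])
        (auto simp: plain_def straight_def row_labelled_W)
  next
    case E_row
    then have r: "row_labelled n E_row i (\<lambda>j. D (i, j)) (V i) (H (i - 1)) (H i)"
      using row[OF assms(1)] by simp
    have "V i (j - 1) \<noteq> H (i - 1) j"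
      using level_count[of "i - 1" "V i (j - 1)"] nz r assms
      by (intro exchange_distinct[OF row_labelled_E_exchange[OF r] assms(2)])
        (auto simp: plain_def straight_def row_labelled_E)
    moreover have "H (i - 1) j = H i j"
      using tile(2)[OF assms(1,2), of South North] assms(3) by simp
    ultimately show ?thesis by simp
  qed
qed

text \<open>The two labels at a cross tile determine the pair, in increasing order, so the crossing
  sets of the pairs partition the cross tiles.\<close>

lemma card_Cross:
  "card {(i, j) \<in> {1..m} \<times> {1..n}. D (i, j) = Cross} =
     (\<Sum>(p, q)\<in>{(p, q). 0 < p \<and> p < q \<and> q \<le> m}. card (crossings m n \<beta> D p q))"
proof -
  let ?P = "{(p, q). 0 < p \<and> p < q \<and> q \<le> m}"
  have fin: "finite ?P" by (rule finite_subset[of _ "{..m} \<times> {..m}"]) auto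
  have cr: "(i, j) \<in> crossings m n \<beta> D p q \<longleftrightarrow> i \<in> {1..m} \<and> j \<in> {1..n} \<and> D (i, j) = Cross \<and>
    (V i (j - 1) = p \<and> H i j = q \<or> V i (j - 1) = q \<and> H i j = p)" if "(p, q) \<in> ?P" for i j p q
    using that by (subst crossings_eq) (auto simp: row_crossings_def meetings_def)
  have "{(i, j) \<in> {1..m} \<times> {1..n}. D (i, j) = Cross} =
      (\<Union>pq\<in>?P. crossings m n \<beta> D (fst pq) (snd pq))"
  proof (intro equalityI subsetI)
    fix x assume x: "x \<in> {(i, j) \<in> {1..m} \<times> {1..n}. D (i, j) = Cross}"
    then obtain i j where ij: "x = (i, j)" "i \<in> {1..m}" "j \<in> {1..n}" "D (i, j) = Cross" by auto
    define p q where "p = min (V i (j - 1)) (H i j)" and "q = max (V i (j - 1)) (H i j)"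
    have "H i j \<le> m" "V i (j - 1) \<le> m"
      using ij Cross_distinct[OF ij(2-4)] level_range(2)[of i j] carry_range(2)[of i "j - 1"] by auto
    then have "(p, q) \<in> ?P"
      using Cross_distinct[OF ij(2-4)] by (auto simp: p_def q_def)
    moreover have "x \<in> crossings m n \<beta> D p q"
      using ij unfolding \<open>x = (i, j)\<close> cr[OF \<open>(p, q) \<in> ?P\<close>] by (auto simp: p_def q_def min_def max_def)
    ultimately show "x \<in> (\<Union>pq\<in>?P. crossings m n \<beta> D (fst pq) (snd pq))" by force
  qed (auto simp: crossings_def)
  moreover have "disjoint_family_on (\<lambda>pq. crossings m n \<beta> D (fst pq) (snd pq)) ?P"
  proof -
    have "(p, q) = (p', q')" if "(p, q) \<in> ?P" "(p', q') \<in> ?P"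
      "(i, j) \<in> crossings m n \<beta> D p q" "(i, j) \<in> crossings m n \<beta> D p' q'" for p q p' q' i j
      using that(3,4) unfolding cr[OF that(1)] cr[OF that(2)] using that(1,2) by auto
    then show ?thesis unfolding disjoint_family_on_def by fastforce
  qed
  moreover have "finite (crossings m n \<beta> D p q)" for p q
    by (rule finite_subset[of _ "{1..m} \<times> {1..n}"]) (auto simp: crossings_def)
  ultimately show ?thesis
    using fin by (simp add: card_UN_disjoint' case_prod_unfold)
qed

end

subsection \<open>Inversions of the completion\<close>

lemma card_symmetric_pairs:
  fixes S :: "nat set"
  assumes "finite S" and sym: "\<And>a b. R a b \<Longrightarrow> R b a" and irrefl: "\<And>a. \<not> R a a"
  shows "card {(a, b) \<in> S \<times> S. R a b} = 2 * card {(a, b) \<in> S \<times> S. a < b \<and> R a b}"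
proof -
  let ?U = "{(a, b) \<in> S \<times> S. a < b \<and> R a b}"
  have "{(a, b) \<in> S \<times> S. R a b} = ?U \<union> prod.swap ` ?U"
  proof (intro equalityI subsetI)
    fix x assume "x \<in> {(a, b) \<in> S \<times> S. R a b}"
    then obtain a b where x: "x = (a, b)" "a \<in> S" "b \<in> S" "R a b" by auto
    then consider "a < b" | "b < a" using irrefl[of a] by (cases a b rule: linorder_cases) auto
    then show "x \<in> ?U \<union> prod.swap ` ?U"
    proof cases
      case 2
      then have "(b, a) \<in> ?U" using x sym by blast
      then show ?thesis using x(1) by force
    qed (use x in auto)
  qed (auto intro: sym)
  moreover have "finite ?U" by (rule finite_subset[of _ "S \<times> S"]) (use assms(1) in auto)
  moreover have "?U \<inter> prod.swap ` ?U = {}" by auto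
  moreover have "card (prod.swap ` ?U) = card ?U" by (intro card_image) simp
  ultimately show ?thesis by (simp add: card_Un_disjoint)
qed

text \<open>A bijection preserves the number of ordered pairs, which for a symmetric irreflexive
  relation is twice the number of increasing ones. This passes from pairs of rows to pairs of pipe
  numbers, whose orders differ.\<close>

lemma card_less_permuted_pairs:
  assumes "bij_betw nu {1..m} {1..m::nat}" and sym: "\<And>a b. R a b \<Longrightarrow> R b a" and irrefl: "\<And>a. \<not> R a a"
  shows "card {(p, q) \<in> {1..m} \<times> {1..m}. p < q \<and> R (nu p) (nu q)} =
    card {(a, b) \<in> {1..m} \<times> {1..m}. a < b \<and> R a b}"
proof -
  have inj: "inj_on nu {1..m}" and img: "nu ` {1..m} = {1..m}"
    using assms(1) by (auto simp: bij_betw_def)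
  have "bij_betw (map_prod nu nu) {(p, q) \<in> {1..m} \<times> {1..m}. R (nu p) (nu q)}
      {(a, b) \<in> {1..m} \<times> {1..m}. R a b}"
    unfolding bij_betw_def
  proof
    show "inj_on (map_prod nu nu) {(p, q) \<in> {1..m} \<times> {1..m}. R (nu p) (nu q)}"
      using map_prod_inj_on[OF inj inj] by (rule inj_on_subset) auto
    show "map_prod nu nu ` {(p, q) \<in> {1..m} \<times> {1..m}. R (nu p) (nu q)} =
        {(a, b) \<in> {1..m} \<times> {1..m}. R a b}" (is "?L = ?R")
    proof (intro equalityI subsetI)
      fix x assume "x \<in> ?R"
      then obtain a b where x: "x = (a, b)" "a \<in> nu ` {1..m}" "b \<in> nu ` {1..m}" "R a b"
        unfolding img by auto
      then show "x \<in> ?L" by force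
    next
      fix x assume "x \<in> ?L"
      then obtain p q where "x = (nu p, nu q)" "p \<in> {1..m}" "q \<in> {1..m}" "R (nu p) (nu q)" by auto
      then show "x \<in> ?R" using img by blast
    qed
  qed
  then have "card {(p, q) \<in> {1..m} \<times> {1..m}. R (nu p) (nu q)} = card {(a, b) \<in> {1..m} \<times> {1..m}. R a b}"
    by (rule bij_betw_same_card)
  then show ?thesis
    using card_symmetric_pairs[of "{1..m}" R] card_symmetric_pairs[of "{1..m}" "\<lambda>p q. R (nu p) (nu q)"]
      sym irrefl by simp
qed

lemma partial_perm_le: "partial_perm m n \<pi> \<Longrightarrow> m \<le> n"
  using card_inj_on_le[of \<pi> "{1..m}" "{1..n}"] by (auto simp: partial_perm_def)

text \<open>An index \<open>a \<le> m\<close> forms inversions with the later positions holding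
  columns left of \<open>\<pi> a\<close> that \<open>\<pi>\<close> misses; these are the
  \<open>\<pi> a - 1\<close> columns on the left less those that \<open>\<pi>\<close> hits. Over all
  \<open>a\<close> the latter number \<open>m (m - 1) / 2\<close>. Terms stand on both sides to
  avoid truncated subtraction.\<close>

lemma inversions_completion:
  assumes "partial_perm m n \<pi>"
  shows "inversions n (completion m n \<pi>) + \<Sum>{1..m} =
    card {(a, b) \<in> {1..m} \<times> {1..m}. a < b \<and> \<pi> b < \<pi> a} + (\<Sum>a\<in>{1..m}. \<pi> a)"
proof -
  have inj: "inj_on \<pi> {1..m}" and rng: "\<And>a. a \<in> {1..m} \<Longrightarrow> \<pi> a \<in> {1..n}"
    using assms by (auto simp: partial_perm_def)
  note mn = partial_perm_le[OF assms]
  define w where "w = completion m n \<pi>"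
  define J where "J = {1..n} - \<pi> ` {1..m}"
  define js where "js = sorted_list_of_set J"
  have w1: "w i = \<pi> i" if "i \<le> m" for i using that by (simp add: w_def completion_def)
  have w2: "w i = js ! (i - m - 1)" if "m < i" for i
    using that by (simp add: w_def completion_def js_def J_def)
  have "card J = n - m"
    unfolding J_def using inj rng by (subst card_Diff_subset) (auto simp: card_image)
  then have len: "length js = n - m" by (simp add: js_def)
  have js: "sorted_wrt (<) js" "distinct js" "set js = J"
    by (simp_all add: js_def J_def strict_sorted_iff)
  define I1 where "I1 = {(a, b) \<in> {1..m} \<times> {1..m}. a < b \<and> \<pi> b < \<pi> a}"
  define I2 where "I2 = (SIGMA a:{1..m}. {k \<in> {m<..n}. w k < \<pi> a})"
  have "{(i, j). 1 \<le> i \<and> i < j \<and> j \<le> n \<and> w i > w j} = I1 \<union> I2"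
  proof (intro equalityI subsetI)
    fix x assume "x \<in> {(i, j). 1 \<le> i \<and> i < j \<and> j \<le> n \<and> w i > w j}"
    then obtain i j where x: "x = (i, j)" "1 \<le> i" "i < j" "j \<le> n" "w j < w i" by auto
    have "i \<le> m"
    proof (rule ccontr)
      assume "\<not> i \<le> m"
      then have "js ! (i - m - 1) < js ! (j - m - 1)"
        using x len by (intro sorted_wrt_nth_less[OF js(1)]) auto
      then show False using x \<open>\<not> i \<le> m\<close> by (simp add: w2)
    qed
    then show "x \<in> I1 \<union> I2" using x by (cases "j \<le> m") (auto simp: I1_def I2_def w1)
  qed (use mn in \<open>auto simp: I1_def I2_def w1\<close>)
  then have "inversions n w = card (I1 \<union> I2)" by (simp add: inversions_def)
  also have "\<dots> = card I1 + card I2"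
    by (intro card_Un_disjoint) (auto simp: I1_def I2_def intro: finite_subset[of _ "{1..m} \<times> {1..m}"])
  also have "card I2 = (\<Sum>a\<in>{1..m}. card {k \<in> {m<..n}. w k < \<pi> a})"
    unfolding I2_def by (subst card_SigmaI) auto
  finally have inv: "inversions n w = card I1 + (\<Sum>a\<in>{1..m}. card {k \<in> {m<..n}. w k < \<pi> a})" .
  have gap: "card {k \<in> {m<..n}. w k < \<pi> a} + card {b \<in> {1..m}. \<pi> b < \<pi> a} + 1 = \<pi> a" if a: "a \<in> {1..m}" for a
  proof -
    have "bij_betw w {k \<in> {m<..n}. w k < \<pi> a} {c \<in> J. c < \<pi> a}"
      unfolding bij_betw_def
    proof
      show "inj_on w {k \<in> {m<..n}. w k < \<pi> a}"
        using len by (auto simp: inj_on_def w2 nth_eq_iff_index_eq[OF js(2)])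
      have "c \<in> w ` {m<..n}" if "c \<in> J" for c
      proof -
        obtain t where "t < length js" "js ! t = c" using \<open>c \<in> J\<close> js(3) by (metis in_set_conv_nth)
        then have "w (m + 1 + t) = c" "m + 1 + t \<in> {m<..n}" using len by (auto simp: w2)
        then show ?thesis by blast
      qed
      moreover have "w k \<in> J" if "k \<in> {m<..n}" for k
        using that len js(3) nth_mem[of "k - m - 1" js] by (auto simp: w2)
      ultimately show "w ` {k \<in> {m<..n}. w k < \<pi> a} = {c \<in> J. c < \<pi> a}" by blast
    qed
    then have 1: "card {k \<in> {m<..n}. w k < \<pi> a} = card {c \<in> J. c < \<pi> a}" by (rule bij_betw_same_card)
    have "inj_on \<pi> {b \<in> {1..m}. \<pi> b < \<pi> a}" using inj by (rule inj_on_subset) auto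
    then have 2: "card {b \<in> {1..m}. \<pi> b < \<pi> a} = card (\<pi> ` {b \<in> {1..m}. \<pi> b < \<pi> a})" by (simp add: card_image)
    have "{1..<\<pi> a} = {c \<in> J. c < \<pi> a} \<union> \<pi> ` {b \<in> {1..m}. \<pi> b < \<pi> a}"
    proof (intro equalityI subsetI)
      fix c assume c: "c \<in> {1..<\<pi> a}"
      then have "c \<in> {1..n}" using rng[OF a] by auto
      then show "c \<in> {c \<in> J. c < \<pi> a} \<union> \<pi> ` {b \<in> {1..m}. \<pi> b < \<pi> a}"
        using c by (cases "c \<in> \<pi> ` {1..m}") (auto simp: J_def)
    next
      fix c assume "c \<in> {c \<in> J. c < \<pi> a} \<union> \<pi> ` {b \<in> {1..m}. \<pi> b < \<pi> a}"
      then show "c \<in> {1..<\<pi> a}" using rng by (fastforce simp: J_def)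
    qed
    moreover have "card ({c \<in> J. c < \<pi> a} \<union> \<pi> ` {b \<in> {1..m}. \<pi> b < \<pi> a}) =
        card {c \<in> J. c < \<pi> a} + card (\<pi> ` {b \<in> {1..m}. \<pi> b < \<pi> a})"
      by (intro card_Un_disjoint) (auto simp: J_def)
    ultimately have "card {1..<\<pi> a} = card {c \<in> J. c < \<pi> a} + card (\<pi> ` {b \<in> {1..m}. \<pi> b < \<pi> a})" by simp
    then have "\<pi> a - 1 = card {k \<in> {m<..n}. w k < \<pi> a} + card {b \<in> {1..m}. \<pi> b < \<pi> a}"
      using 1 2 by simp
    moreover have "1 \<le> \<pi> a" using rng[OF a] by simp
    ultimately show ?thesis by linarith
  qed
  \<comment> \<open>Of two distinct indices exactly one has the smaller value, so \<open>L\<close>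
    contains half of the off-diagonal pairs.\<close>
  have pairs: "(\<Sum>a\<in>{1..m}. card {b \<in> {1..m}. \<pi> b < \<pi> a}) + m = \<Sum>{1..m}"
  proof -
    define L where "L = {(a, b) \<in> {1..m} \<times> {1..m}. \<pi> b < \<pi> a}"
    have "(\<Sum>a\<in>{1..m}. card {b \<in> {1..m}. \<pi> b < \<pi> a}) = card (SIGMA a:{1..m}. {b \<in> {1..m}. \<pi> b < \<pi> a})"
      by (subst card_SigmaI) auto
    also have "(SIGMA a:{1..m}. {b \<in> {1..m}. \<pi> b < \<pi> a}) = L" by (auto simp: L_def)
    finally have sum: "(\<Sum>a\<in>{1..m}. card {b \<in> {1..m}. \<pi> b < \<pi> a}) = card L" .
    have "{(a, b) \<in> {1..m} \<times> {1..m}. a \<noteq> b} = L \<union> prod.swap ` L"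
    proof (intro equalityI subsetI)
      fix x assume "x \<in> {(a, b) \<in> {1..m} \<times> {1..m}. a \<noteq> b}"
      then obtain a b where x: "x = (a, b)" "a \<in> {1..m}" "b \<in> {1..m}" "a \<noteq> b" by auto
      then have "\<pi> a \<noteq> \<pi> b" using inj_onD[OF inj, of a b] by blast
      then have "(a, b) \<in> L \<or> (b, a) \<in> L" using x by (auto simp: L_def)
      then show "x \<in> L \<union> prod.swap ` L" using x(1) by force
    qed (auto simp: L_def)
    moreover have "card (L \<union> prod.swap ` L) = card L + card (prod.swap ` L)"
      by (intro card_Un_disjoint) (auto simp: L_def intro: finite_subset[of _ "{1..m} \<times> {1..m}"])
    moreover have "card (prod.swap ` L) = card L" by (intro card_image) simp
    moreover have "card {(a, b) \<in> {1..m} \<times> {1..m}. a \<noteq> b} = m * (m - 1)"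
    proof -
      have "{(a, b) \<in> {1..m} \<times> {1..m}. a \<noteq> b} = (SIGMA a:{1..m}. {1..m} - {a})" by auto
      then show ?thesis by (simp add: card_SigmaI)
    qed
    ultimately have "2 * card L = m * (m - 1)" by simp
    moreover have "2 * \<Sum>{1..m} = m * (m + 1)"
      by (induction m) simp_all
    moreover have "m * (m + 1) = m * (m - 1) + 2 * m" by (cases m) simp_all
    ultimately show ?thesis using sum by linarith
  qed
  have "(\<Sum>a\<in>{1..m}. \<pi> a) =
      (\<Sum>a\<in>{1..m}. card {k \<in> {m<..n}. w k < \<pi> a} + card {b \<in> {1..m}. \<pi> b < \<pi> a} + 1)"
    using gap by (intro sum.cong) simp_all
  also have "\<dots> = (\<Sum>a\<in>{1..m}. card {k \<in> {m<..n}. w k < \<pi> a}) +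
      ((\<Sum>a\<in>{1..m}. card {b \<in> {1..m}. \<pi> b < \<pi> a}) + m)"
    unfolding sum.distrib by simp
  finally show ?thesis using inv pairs by (simp add: w_def I1_def)
qed

subsection \<open>The numbering of the pipes\<close>

text \<open>Counterclockwise, a pipe entering from the West precedes all pipes entering further
  down, on either side, and one entering from the East follows all of them.\<close>

lemma pipe_number_less_iff:
  assumes "p \<in> {1..m}" "q \<in> {1..m}" "p < q"
  shows "pipe_number m \<beta> p < pipe_number m \<beta> q \<longleftrightarrow> \<beta> p = W_row"
    and "pipe_number m \<beta> p \<noteq> pipe_number m \<beta> q"
proof -
  have W: "card {r \<in> {1..i}. \<beta> r = W_row} \<le> card {r \<in> {1..m}. \<beta> r = W_row}" if "i \<in> {1..m}" for i
    using that by (intro card_mono) auto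
  have E: "card {r \<in> {i..m}. \<beta> r = E_row} > 0" if "i \<in> {1..m}" "\<beta> i = E_row" for i
    using that by (auto simp: card_gt_0_iff)
  have WW: "card {r \<in> {1..p}. \<beta> r = W_row} < card {r \<in> {1..q}. \<beta> r = W_row}" if "\<beta> q = W_row"
  proof (intro psubset_card_mono psubsetI)
    have "q \<in> {r \<in> {1..q}. \<beta> r = W_row} - {r \<in> {1..p}. \<beta> r = W_row}" using that assms by simp
    then show "{r \<in> {1..p}. \<beta> r = W_row} \<noteq> {r \<in> {1..q}. \<beta> r = W_row}" by blast
  qed (use assms in auto)
  have EE: "card {r \<in> {q..m}. \<beta> r = E_row} < card {r \<in> {p..m}. \<beta> r = E_row}" if "\<beta> p = E_row"
  proof (intro psubset_card_mono psubsetI)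
    have "p \<in> {r \<in> {p..m}. \<beta> r = E_row} - {r \<in> {q..m}. \<beta> r = E_row}" using that assms by simp
    then show "{r \<in> {q..m}. \<beta> r = E_row} \<noteq> {r \<in> {p..m}. \<beta> r = E_row}" by blast
  qed (use assms in auto)
  have "pipe_number m \<beta> p < pipe_number m \<beta> q \<and> \<beta> p = W_row \<or>
      pipe_number m \<beta> q < pipe_number m \<beta> p \<and> \<beta> p = E_row"
    using W[OF assms(1)] W[OF assms(2)] E[OF assms(1)] E[OF assms(2)] WW EE
    by (cases "\<beta> p"; cases "\<beta> q") (simp_all add: pipe_number_def)
  then show "pipe_number m \<beta> p < pipe_number m \<beta> q \<longleftrightarrow> \<beta> p = W_row"
    "pipe_number m \<beta> p \<noteq> pipe_number m \<beta> q" by auto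
qed

lemma pipe_number_bij: "bij_betw (pipe_number m \<beta>) {1..m} {1..m}"
proof -
  have inj: "inj_on (pipe_number m \<beta>) {1..m}"
  proof (rule linorder_inj_onI)
    show "pipe_number m \<beta> p \<noteq> pipe_number m \<beta> q" if "p < q" "p \<in> {1..m}" "q \<in> {1..m}" for p q
      using pipe_number_less_iff(2) that by blast
  qed auto
  have "pipe_number m \<beta> i \<in> {1..m}" if i: "i \<in> {1..m}" for i
  proof (cases "\<beta> i")
    case W_row
    have "{r \<in> {1..i}. \<beta> r = W_row} \<noteq> {}" using i W_row by auto
    then have "0 < card {r \<in> {1..i}. \<beta> r = W_row}" by (simp add: card_gt_0_iff)
    moreover have "card {r \<in> {1..i}. \<beta> r = W_row} \<le> card {1..m}"
      using i by (intro card_mono) auto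
    ultimately show ?thesis using W_row by (simp add: pipe_number_def)
  next
    case E_row
    have "{r \<in> {i..m}. \<beta> r = E_row} \<noteq> {}" using i E_row by auto
    then have "0 < card {r \<in> {i..m}. \<beta> r = E_row}" by (simp add: card_gt_0_iff)
    moreover have "card {r \<in> {1..m}. \<beta> r = W_row} + card {r \<in> {i..m}. \<beta> r = E_row} =
        card ({r \<in> {1..m}. \<beta> r = W_row} \<union> {r \<in> {i..m}. \<beta> r = E_row})"
      by (intro card_Un_disjoint[symmetric]) auto
    moreover have "\<dots> \<le> card {1..m}" using i by (intro card_mono) auto
    ultimately show ?thesis using E_row by (simp add: pipe_number_def)
  qed
  then have "pipe_number m \<beta> ` {1..m} \<subseteq> {1..m}" by blast
  then have "pipe_number m \<beta> ` {1..m} = {1..m}" using inj by (intro endo_inj_surj) auto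
  with inj show ?thesis by (simp add: bij_betw_def)
qed

subsection \<open>Counting tiles\<close>

text \<open>One for tiles whose weight is free of \<open>B\<close>, zero for those whose weight has
  degree one in \<open>B\<close>.\<close>

definition tile_loss :: "row_type \<Rightarrow> tile \<Rightarrow> nat" where
  "tile_loss b t = of_bool (b = W_row \<and> straight t \<or> b = E_row \<and> t = Blank)"

definition loss :: "nat \<Rightarrow> nat \<Rightarrow> (nat \<Rightarrow> row_type) \<Rightarrow> filling \<Rightarrow> nat" where
  "loss m n \<beta> D = (\<Sum>(i, j)\<in>{1..m} \<times> {1..n}. tile_loss (\<beta> i) (D (i, j)))"

text \<open>The coefficients 2 and 1 are forced by the tile-by-tile identities in
  \<open>level_sum_step\<close>.\<close>

definition bad_tile :: "row_type \<Rightarrow> tile \<Rightarrow> nat" where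
  "bad_tile b t = 2 * of_bool (b = W_row \<and> t = Vertical) + of_bool (b = E_row \<and> t = Double_EN_SW)"

lemma Abel_sum_carry:
  fixes v :: "nat \<Rightarrow> int"
  shows "(\<Sum>j=1..n. int j * (v (j - 1) - v j)) = (\<Sum>j=1..n. v (j - 1)) - int n * v n"
  by (induction n) (simp_all add: algebra_simps)

context labelled_filling
begin

lemma card_level:
  assumes "k \<le> m"
  shows "card {j\<in>{1..n}. H k j \<noteq> 0} = m - k"
proof -
  have "{j\<in>{1..n}. H k j \<noteq> 0} = (\<Union>x\<in>{k<..m}. {j\<in>{1..n}. H k j = x})"
    using level_range[OF assms] by auto
  moreover have "card \<dots> = (\<Sum>x\<in>{k<..m}. card {j\<in>{1..n}. H k j = x})"
    by (intro card_UN_disjoint) auto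
  moreover have "\<dots> = (\<Sum>x\<in>{k<..m}. 1)"
    using level_count[OF assms] by (intro sum.cong) auto
  ultimately show ?thesis by simp
qed

text \<open>The sum of the occupied columns at level \<open>k\<close>: zero at the bottom, the sum
  of the values of \<open>\<pi>\<close> at the top.\<close>

definition level_sum :: "nat \<Rightarrow> int" where
  "level_sum k = (\<Sum>j=1..n. int j * of_bool (H k j \<noteq> 0))"

lemma level_sum_step:
  assumes i: "i \<in> {1..m}"
  shows "level_sum (i - 1) - level_sum i = (int m + 1 - int i) + (\<Sum>j=1..n. int (tile_loss (\<beta> i) (D (i, j)))
     - int (bad_tile (\<beta> i) (D (i, j)) + of_bool (D (i, j) = Cross)))"
proof -
  let ?nz = "\<lambda>x::nat. of_bool (x \<noteq> 0) :: int"
  have labels: "?nz (H i j) = of_bool (uses (D (i, j)) South)"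
    "?nz (H (i - 1) j) = of_bool (uses (D (i, j)) North)"
    "?nz (V i (j - 1)) = of_bool (uses (D (i, j)) West)"
    "?nz (V i j) = of_bool (uses (D (i, j)) East)" if "j \<in> {1..n}" for j
    using tile(3)[OF i that, of South] tile(3)[OF i that, of North]
      tile(3)[OF i that, of West] tile(3)[OF i that, of East] by simp_all
  have occ: "(\<Sum>j=1..n. ?nz (H (i - 1) j)) = int m + 1 - int i"
  proof -
    have "i - 1 \<le> m" "int (m - (i - 1)) = int m + 1 - int i" using i by auto
    moreover have "(\<Sum>j=1..n. ?nz (H (i - 1) j)) = int (card {j\<in>{1..n}. H (i - 1) j \<noteq> 0})"
      by (simp add: sum_of_bool_eq Int_def)
    ultimately show ?thesis using card_level[of "i - 1"] by simp
  qed
  have "level_sum (i - 1) - level_sum i = (\<Sum>j=1..n. int j * (?nz (H (i - 1) j) - ?nz (H i j)))"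
    by (simp add: level_sum_def sum_subtractf algebra_simps)
  also have "\<dots> = (\<Sum>j=1..n. ?nz (H (i - 1) j)) + (\<Sum>j=1..n. int (tile_loss (\<beta> i) (D (i, j)))
     - int (bad_tile (\<beta> i) (D (i, j)) + of_bool (D (i, j) = Cross)))"
  proof (cases "\<beta> i")
    case W_row
    have a: "D (i, j) \<in> allowed W_row" if "j \<in> {1..n}" for j using tile(1)[OF i that] W_row by simp
    have "?nz (H (i - 1) j) - ?nz (H i j) = ?nz (V i (j - 1)) - ?nz (V i j)" if "j \<in> {1..n}" for j
      unfolding labels[OF that] using a[OF that] by (cases "D (i, j)") (simp_all add: uses_iff)
    then have "(\<Sum>j=1..n. int j * (?nz (H (i - 1) j) - ?nz (H i j))) =
        (\<Sum>j=1..n. int j * (?nz (V i (j - 1)) - ?nz (V i j)))"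
      by (intro sum.cong) simp_all
    also have "\<dots> = (\<Sum>j=1..n. ?nz (V i (j - 1)))"
      unfolding Abel_sum_carry[of "\<lambda>j. ?nz (V i j)"] using row[OF i] W_row by (simp add: row_labelled_W)
    also have "\<dots> = (\<Sum>j=1..n. ?nz (H (i - 1) j) + (int (tile_loss (\<beta> i) (D (i, j)))
        - int (bad_tile (\<beta> i) (D (i, j)) + of_bool (D (i, j) = Cross))))"
    proof (intro sum.cong refl)
      fix j assume j: "j \<in> {1..n}"
      show "?nz (V i (j - 1)) = ?nz (H (i - 1) j) + (int (tile_loss (\<beta> i) (D (i, j)))
        - int (bad_tile (\<beta> i) (D (i, j)) + of_bool (D (i, j) = Cross)))"
        unfolding labels[OF j] W_row using a[OF j]
        by (cases "D (i, j)") (simp_all add: uses_iff tile_loss_def bad_tile_def straight_def)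
    qed
    finally show ?thesis by (simp only: sum.distrib)
  next
    case E_row
    have a: "D (i, j) \<in> allowed E_row" if "j \<in> {1..n}" for j using tile(1)[OF i that] E_row by simp
    have eq: "?nz (H (i - 1) j) - ?nz (H i j) = - (?nz (V i (j - 1)) - ?nz (V i j))" if "j \<in> {1..n}" for j
      unfolding labels[OF that] using a[OF that] by (cases "D (i, j)") (simp_all add: uses_iff)
    have "(\<Sum>j=1..n. int j * (?nz (H (i - 1) j) - ?nz (H i j))) =
        (\<Sum>j=1..n. - (int j * (?nz (V i (j - 1)) - ?nz (V i j))))"
    proof (rule sum.cong[OF refl])
      show "int j * (?nz (H (i - 1) j) - ?nz (H i j)) = - (int j * (?nz (V i (j - 1)) - ?nz (V i j)))"
        if "j \<in> {1..n}" for j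
        unfolding eq[OF that] by (rule mult_minus_right)
    qed
    also have "\<dots> = int n - (\<Sum>j=1..n. ?nz (V i (j - 1)))"
      unfolding sum_negf Abel_sum_carry[of "\<lambda>j. ?nz (V i j)"]
      using row[OF i] E_row i by (simp add: row_labelled_E)
    also have "\<dots> = (\<Sum>j=1..n. 1 - ?nz (V i (j - 1)))"
      by (simp add: sum_subtractf)
    also have "\<dots> = (\<Sum>j=1..n. ?nz (H (i - 1) j) + (int (tile_loss (\<beta> i) (D (i, j)))
        - int (bad_tile (\<beta> i) (D (i, j)) + of_bool (D (i, j) = Cross))))"
    proof (intro sum.cong refl)
      fix j assume j: "j \<in> {1..n}"
      show "1 - ?nz (V i (j - 1)) = ?nz (H (i - 1) j) + (int (tile_loss (\<beta> i) (D (i, j)))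
        - int (bad_tile (\<beta> i) (D (i, j)) + of_bool (D (i, j) = Cross)))"
        unfolding labels[OF j] E_row using a[OF j]
        by (cases "D (i, j)") (simp_all add: uses_iff tile_loss_def bad_tile_def straight_def)
    qed
    finally show ?thesis by (simp only: sum.distrib)
  qed
  finally show ?thesis unfolding occ .
qed

text \<open>Telescoping over the rows; the occupancies \<open>m + 1 - i\<close> add up to the
  triangular number on the left.\<close>

lemma loss_level_sum:
  "int (loss m n \<beta> D) + int (\<Sum>{1..m}) = level_sum 0 +
     int (\<Sum>(i, j)\<in>{1..m} \<times> {1..n}. bad_tile (\<beta> i) (D (i, j))) +
     int (card {(i, j) \<in> {1..m} \<times> {1..n}. D (i, j) = Cross})"
proof -
  let ?loss = "\<lambda>i j. int (tile_loss (\<beta> i) (D (i, j)))"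
  let ?bad = "\<lambda>i j. int (bad_tile (\<beta> i) (D (i, j)))"
  let ?cr = "\<lambda>i j. of_bool (D (i, j) = Cross) :: int"
  have "(\<Sum>i=1..k. level_sum (i - 1) - level_sum i) = level_sum 0 - level_sum k" for k
    by (induction k) simp_all
  moreover have "level_sum m = 0" using bottom by (simp add: level_sum_def)
  ultimately have "level_sum 0 = (\<Sum>i=1..m. level_sum (i - 1) - level_sum i)" by simp
  also have "\<dots> = (\<Sum>i=1..m. (int m + 1 - int i) + (\<Sum>j=1..n. ?loss i j - (?bad i j + ?cr i j)))"
  proof (rule sum.cong[OF refl])
    show "level_sum (i - 1) - level_sum i =
        (int m + 1 - int i) + (\<Sum>j=1..n. ?loss i j - (?bad i j + ?cr i j))" if "i \<in> {1..m}" for i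
      unfolding level_sum_step[OF that] by simp
  qed
  also have "\<dots> = (\<Sum>i=1..m. int m + 1 - int i) + (\<Sum>i=1..m. \<Sum>j=1..n. ?loss i j) -
      ((\<Sum>i=1..m. \<Sum>j=1..n. ?bad i j) + (\<Sum>i=1..m. \<Sum>j=1..n. ?cr i j))"
    by (simp only: sum.distrib sum_subtractf)
  also have "(\<Sum>i=1..m. int m + 1 - int i) = int (\<Sum>{1..m})"
  proof -
    have "(\<Sum>i=1..m. int m + 1 - int i) = (\<Sum>i=1..m. int (m + 1 - i))"
      by (intro sum.cong) auto
    also have "\<dots> = (\<Sum>i=1..m. int i)"
      using sum.atLeastAtMost_rev[of int 1 m] by simp
    finally show ?thesis by simp
  qed
  also have "(\<Sum>i=1..m. \<Sum>j=1..n. ?loss i j) = int (loss m n \<beta> D)"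
    by (simp add: loss_def sum.cartesian_product case_prod_unfold)
  also have "(\<Sum>i=1..m. \<Sum>j=1..n. ?bad i j) = int (\<Sum>(i, j)\<in>{1..m} \<times> {1..n}. bad_tile (\<beta> i) (D (i, j)))"
    by (simp add: sum.cartesian_product case_prod_unfold)
  also have "(\<Sum>i=1..m. \<Sum>j=1..n. ?cr i j) = int (card {(i, j) \<in> {1..m} \<times> {1..n}. D (i, j) = Cross})"
  proof -
    have "(\<Sum>i=1..m. \<Sum>j=1..n. ?cr i j) = (\<Sum>x\<in>{1..m} \<times> {1..n}. of_bool (D x = Cross))"
      by (simp add: sum.cartesian_product case_prod_unfold del: sum_of_bool_eq)
    also have "\<dots> = int (card ({1..m} \<times> {1..n} \<inter> {x. D x = Cross}))"
      by (simp add: sum_of_bool_eq)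
    also have "{1..m} \<times> {1..n} \<inter> {x. D x = Cross} = {(i, j) \<in> {1..m} \<times> {1..n}. D (i, j) = Cross}"
      by auto
    finally show ?thesis .
  qed
  finally show ?thesis by simp
qed

section \<open>Loss and inversions for a given connectivity\<close>

lemma connectivity_label:
  assumes "partial_perm m n \<pi>"
  shows "has_connectivity m n \<beta> D \<pi> \<longleftrightarrow> (\<forall>p\<in>{1..m}. H 0 (\<pi> (pipe_number m \<beta> p)) = p)"
proof -
  have "\<pi> (pipe_number m \<beta> p) \<in> {1..n}" if "p \<in> {1..m}" for p
    using assms that bij_betwE[OF pipe_number_bij, of m \<beta>] by (auto simp: partial_perm_def)
  then show ?thesis using HEdge_pipe_iff[of 0] by (simp add: has_connectivity_def)
qed

context
  fixes \<pi> :: "nat \<Rightarrow> nat"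
  assumes \<pi>: "partial_perm m n \<pi>" and conn: "has_connectivity m n \<beta> D \<pi>"
begin

lemma exit_column:
  assumes "p \<in> {1..m}"
  shows "occurs_only_at {1..n} (H 0) p (\<pi> (pipe_number m \<beta> p))"
proof -
  obtain a where a: "occurs_only_at {1..n} (H 0) p a"
    using level_column[of 0 p] assms by auto
  have "\<pi> (pipe_number m \<beta> p) \<in> {1..n}"
    using \<pi> assms bij_betwE[OF pipe_number_bij, of m \<beta>] by (auto simp: partial_perm_def)
  moreover have "H 0 (\<pi> (pipe_number m \<beta> p)) = p"
    using conn assms by (simp add: connectivity_label[OF \<pi>])
  ultimately have "\<pi> (pipe_number m \<beta> p) = a" using a by (simp add: occurs_only_at_def)
  then show ?thesis using a by simp
qed

lemma level_sum_top: "level_sum 0 = int (\<Sum>a\<in>{1..m}. \<pi> a)"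
proof -
  let ?c = "\<lambda>p. \<pi> (pipe_number m \<beta> p)"
  have "bij_betw ?c {1..m} {j\<in>{1..n}. H 0 j \<noteq> 0}"
    unfolding bij_betw_def
  proof
    show "inj_on ?c {1..m}"
      using exit_column unfolding inj_on_def occurs_only_at_def by metis
    show "?c ` {1..m} = {j\<in>{1..n}. H 0 j \<noteq> 0}"
    proof (intro equalityI subsetI)
      fix j assume j: "j \<in> {j\<in>{1..n}. H 0 j \<noteq> 0}"
      then have p: "H 0 j \<in> {1..m}" using level_range[of 0 j] by auto
      then have "j = ?c (H 0 j)" using exit_column[OF p] j by (auto simp: occurs_only_at_def)
      then show "j \<in> ?c ` {1..m}" using p by blast
    next
      fix j assume "j \<in> ?c ` {1..m}"
      then obtain p where "p \<in> {1..m}" "j = ?c p" by blast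
      then have "j \<in> {1..n} \<and> H 0 j = p" using exit_column[of p] unfolding occurs_only_at_def by blast
      then show "j \<in> {j\<in>{1..n}. H 0 j \<noteq> 0}" using \<open>p \<in> {1..m}\<close> by simp
    qed
  qed
  then have "(\<Sum>j\<in>{j\<in>{1..n}. H 0 j \<noteq> 0}. int j) = (\<Sum>p\<in>{1..m}. int (?c p))"
    by (rule sum.reindex_bij_betw[symmetric])
  also have "\<dots> = (\<Sum>a\<in>{1..m}. int (\<pi> a))"
    by (rule sum.reindex_bij_betw[OF pipe_number_bij])
  finally have "(\<Sum>j\<in>{j\<in>{1..n}. H 0 j \<noteq> 0}. int j) = int (\<Sum>a\<in>{1..m}. \<pi> a)" by simp
  moreover have "level_sum 0 = (\<Sum>j\<in>{j\<in>{1..n}. H 0 j \<noteq> 0}. int j)"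
    unfolding level_sum_def by (intro sum.mono_neutral_cong_right) auto
  ultimately show ?thesis by simp
qed

text \<open>The order of the exits depends on \<open>\<beta> p\<close> and the parity, the order of
  the pipe numbers on \<open>\<beta> p\<close> alone; eliminating \<open>\<beta> p\<close> leaves
  the inversion condition.\<close>

lemma odd_crossings_iff:
  assumes "p \<in> {1..m}" "q \<in> {1..m}" "p < q"
  defines "a \<equiv> pipe_number m \<beta> p" and "b \<equiv> pipe_number m \<beta> q"
  shows "odd (card (crossings m n \<beta> D p q)) \<longleftrightarrow> (a < b \<and> \<pi> b < \<pi> a \<or> b < a \<and> \<pi> a < \<pi> b)"
proof -
  have "\<pi> a < \<pi> b \<longleftrightarrow> (\<beta> p = W_row \<longleftrightarrow> even (card (crossings m n \<beta> D p q)))"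
    using crossings_parity[of p q] exit_column[OF assms(1)] exit_column[OF assms(2)] assms by auto
  moreover have "\<pi> a \<noteq> \<pi> b"
    using exit_column[OF assms(1)] exit_column[OF assms(2)] assms(3)
    by (metis a_def b_def less_irrefl occurs_only_at_def)
  moreover have "a < b \<longleftrightarrow> \<beta> p = W_row" "a \<noteq> b"
    using pipe_number_less_iff[OF assms(1-3)] by (simp_all add: a_def b_def)
  ultimately show ?thesis by (meson linorder_cases less_asym)
qed

text \<open>The parity indicators, whose sum is the number of inversions of \<open>\<pi>\<close>,
  are added on the left rather than subtracted on the right, which stays within the natural
  numbers.\<close>

lemma loss_inversions:
  "loss m n \<beta> D + (\<Sum>(p, q)\<in>{(p, q). 0 < p \<and> p < q \<and> q \<le> m}. of_bool (odd (card (crossings m n \<beta> D p q)))) =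
   inversions n (completion m n \<pi>) + (\<Sum>(i, j)\<in>{1..m} \<times> {1..n}. bad_tile (\<beta> i) (D (i, j))) +
   (\<Sum>(p, q)\<in>{(p, q). 0 < p \<and> p < q \<and> q \<le> m}. card (crossings m n \<beta> D p q))"
proof -
  let ?P = "{(p, q). 0 < p \<and> p < q \<and> q \<le> m}"
  let ?R = "\<lambda>a b. a < b \<and> \<pi> b < \<pi> a \<or> b < a \<and> \<pi> a < \<pi> b"
  let ?\<nu> = "pipe_number m \<beta>"
  have fin: "finite ?P" by (rule finite_subset[of _ "{..m} \<times> {..m}"]) auto
  have "(\<Sum>(p, q)\<in>?P. of_bool (odd (card (crossings m n \<beta> D p q)))) =
      (\<Sum>x\<in>?P. of_bool (?R (?\<nu> (fst x)) (?\<nu> (snd x))) :: nat)"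
    using odd_crossings_iff by (intro sum.cong) (auto simp: Suc_le_eq)
  also have "\<dots> = card (?P \<inter> {x. ?R (?\<nu> (fst x)) (?\<nu> (snd x))})"
    by (subst sum_of_bool_eq) (use fin in \<open>simp_all only: of_nat_id\<close>)
  also have "?P \<inter> {x. ?R (?\<nu> (fst x)) (?\<nu> (snd x))} =
      {(p, q) \<in> {1..m} \<times> {1..m}. p < q \<and> ?R (?\<nu> p) (?\<nu> q)}"
    by auto
  also have "card \<dots> = card {(a, b) \<in> {1..m} \<times> {1..m}. a < b \<and> ?R a b}"
    by (rule card_less_permuted_pairs[OF pipe_number_bij]) auto
  also have "{(a, b) \<in> {1..m} \<times> {1..m}. a < b \<and> ?R a b} = {(a, b) \<in> {1..m} \<times> {1..m}. a < b \<and> \<pi> b < \<pi> a}"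
    by auto
  finally have odd: "(\<Sum>(p, q)\<in>?P. of_bool (odd (card (crossings m n \<beta> D p q)))) =
      card {(a, b) \<in> {1..m} \<times> {1..m}. a < b \<and> \<pi> b < \<pi> a}" .
  show ?thesis
    using loss_level_sum inversions_completion[OF \<pi>]
    unfolding level_sum_top card_Cross odd by linarith
qed

lemma loss_eq_iff_nongeneric:
  "inversions n (completion m n \<pi>) \<le> loss m n \<beta> D"
  "loss m n \<beta> D = inversions n (completion m n \<pi>) \<longleftrightarrow> nongeneric m n \<beta> D"
proof -
  let ?P = "{(p, q). 0 < p \<and> p < q \<and> q \<le> m}"
  let ?bad = "\<Sum>(i, j)\<in>{1..m} \<times> {1..n}. bad_tile (\<beta> i) (D (i, j))"
  let ?c = "\<lambda>pq. card (crossings m n \<beta> D (fst pq) (snd pq))"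
  have fin: "finite ?P" by (rule finite_subset[of _ "{..m} \<times> {..m}"]) auto
  \<comment> \<open>Each crossing number exceeds its parity by an even amount that vanishes iff the
    number is at most one.\<close>
  have "(\<Sum>pq\<in>?P. ?c pq) = (\<Sum>pq\<in>?P. of_bool (odd (?c pq)) + 2 * (?c pq div 2))"
  proof (rule sum.cong[OF refl])
    show "?c pq = of_bool (odd (?c pq)) + 2 * (?c pq div 2)" for pq
      by (cases "even (?c pq)") simp_all
  qed
  then have "loss m n \<beta> D = inversions n (completion m n \<pi>) + ?bad + (\<Sum>pq\<in>?P. 2 * (?c pq div 2))"
    using loss_inversions by (simp add: sum.distrib case_prod_unfold)
  moreover have "?bad = 0 \<longleftrightarrow> (\<forall>i\<in>{1..m}. \<forall>j\<in>{1..n}.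
      (\<beta> i = W_row \<longrightarrow> D (i, j) \<noteq> Vertical) \<and> (\<beta> i = E_row \<longrightarrow> D (i, j) \<noteq> Double_EN_SW))"
    by (auto simp: bad_tile_def)
  moreover have "(\<Sum>pq\<in>?P. 2 * (?c pq div 2)) = 0 \<longleftrightarrow>
      (\<forall>p\<in>{1..m}. \<forall>q\<in>{1..m}. p \<noteq> q \<longrightarrow> card (crossings m n \<beta> D p q) \<le> 1)"
  proof -
    have "(\<Sum>pq\<in>?P. 2 * (?c pq div 2)) = 0 \<longleftrightarrow> (\<forall>pq\<in>?P. ?c pq \<le> 1)"
      using fin by (auto simp: div_eq_0_iff less_Suc_eq_le numeral_2_eq_2)
    also have "\<dots> \<longleftrightarrow> (\<forall>p\<in>{1..m}. \<forall>q\<in>{1..m}. p < q \<longrightarrow> card (crossings m n \<beta> D p q) \<le> 1)"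
      by (auto simp: Suc_le_eq)
    also have "\<dots> \<longleftrightarrow> (\<forall>p\<in>{1..m}. \<forall>q\<in>{1..m}. p \<noteq> q \<longrightarrow> card (crossings m n \<beta> D p q) \<le> 1)"
    proof -
      have "crossings m n \<beta> D p q = crossings m n \<beta> D q p" for p q
        unfolding crossings_def by blast
      then show ?thesis by (metis linorder_cases less_irrefl)
    qed
    finally show ?thesis .
  qed
  ultimately show "inversions n (completion m n \<pi>) \<le> loss m n \<beta> D"
    "loss m n \<beta> D = inversions n (completion m n \<pi>) \<longleftrightarrow> nongeneric m n \<beta> D"
    unfolding nongeneric_def by linarith+
qed

end

end

subsection \<open>Existence of nongeneric pipe dreams\<close>

text \<open>In the \<open>W\<close> row constructed below, every pipe to the right of the entering
  one leaves through an elbow, so this is the label carried past column \<open>j\<close>; the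
  default 0 means that nothing is carried.\<close>

definition next_label :: "nat \<Rightarrow> (nat \<Rightarrow> nat) \<Rightarrow> nat \<Rightarrow> nat" where
  "next_label n g j = (case find (\<lambda>k. g k \<noteq> 0) [Suc j..<Suc n] of None \<Rightarrow> 0 | Some k \<Rightarrow> g k)"

lemma next_label_last: "next_label n g n = 0"
  by (simp add: next_label_def)

lemma next_label_step:
  "j < n \<Longrightarrow> next_label n g j = (if g (Suc j) \<noteq> 0 then g (Suc j) else next_label n g (Suc j))"
  unfolding next_label_def by (subst upt_rec) simp

text \<open>By the last condition only the entering pipe runs horizontally through crosses, so two
  pipes can cross only in the upper one of their entry rows.\<close>

definition nongeneric_row :: "nat \<Rightarrow> row_type \<Rightarrow> nat \<Rightarrow> (nat \<Rightarrow> tile) \<Rightarrow> (nat \<Rightarrow> nat) \<Rightarrow> bool" where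
  "nongeneric_row n b i T v \<longleftrightarrow> (\<forall>j\<in>{1..n}. (b = W_row \<longrightarrow> T j \<noteq> Vertical) \<and>
     (b = E_row \<longrightarrow> T j \<noteq> Double_EN_SW) \<and> (T j = Cross \<longrightarrow> v (j - 1) = i))"

text \<open>
  The entering pipe goes straight to its column. All pipes to the right of this column move one
  occupied column to the left below the row, because vertical tiles are forbidden.
\<close>

lemma ex_nongeneric_row_W:
  assumes g: "occurs_only_at {1..n} g i c" and "i > 0"
  shows "\<exists>T v f. row_labelled n W_row i T v g f \<and> nongeneric_row n W_row i T v"
proof -
  have c: "1 \<le> c" "c \<le> n" "g c = i" using g by (auto simp: occurs_only_at_def)
  define v where "v j = (if j < c then i else next_label n g j)" for j
  define f where "f j = (if j < c then g j else if g j \<noteq> 0 then v j else 0)" for j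
  define T where "T j =
    (if j < c then (if g j = 0 then Horizontal else Cross)
     else if g j \<noteq> 0 then (if v j \<noteq> 0 then Double_WN_SE else Elbow_WN)
     else if v j \<noteq> 0 then Horizontal else Blank)" for j
  have v: "v (j - 1) = (if g j \<noteq> 0 then g j else v j)" if "c \<le> j" "j \<le> n" for j
  proof (cases "j = c")
    case True
    then show ?thesis using c assms(2) by (simp add: v_def)
  next
    case False
    then have "j = Suc (j - 1)" "j - 1 < n" "c \<le> j - 1" using that by auto
    then show ?thesis using next_label_step[of "j - 1" n g] that by (simp add: v_def)
  qed
  have "T j \<in> allowed W_row \<and> (\<forall>s. uses (T j) s \<longleftrightarrow> side_label v g f j s \<noteq> 0) \<and>
       (if T j = Blank \<or> straight (T j) then v j = v (j - 1) \<and> g j = f j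
        else v j = f j \<and> g j = v (j - 1)) \<and> T j \<noteq> Vertical \<and> (T j = Cross \<longrightarrow> v (j - 1) = i)"
    if j: "j \<in> {1..n}" for j
  proof (cases "j < c")
    case True
    then have "v j = i" "v (j - 1) = i" by (simp_all add: v_def less_imp_diff_less)
    then show ?thesis using True assms(2)
      by (simp add: T_def f_def all_side uses_iff straight_def)
  next
    case False
    then have "v (j - 1) = (if g j \<noteq> 0 then g j else v j)" using v j by simp
    then show ?thesis using False
      by (simp add: T_def f_def all_side uses_iff straight_def)
  qed
  moreover have "v 0 = i" "v n = 0" using c by (simp_all add: v_def next_label_last)
  ultimately have "row_labelled n W_row i T v g f" "nongeneric_row n W_row i T v"
    unfolding row_labelled_W nongeneric_row_def by blast+
  then show ?thesis by blast
qed

text \<open>Vertical tiles are available here: the entering pipe runs West to its column and turns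
  North, and all other pipes keep their columns.\<close>

lemma ex_nongeneric_row_E:
  assumes g: "occurs_only_at {1..n} g i c" and "i > 0"
  shows "\<exists>T v f. row_labelled n E_row i T v g f \<and> nongeneric_row n E_row i T v"
proof -
  have c: "1 \<le> c" "c \<le> n" "g c = i" using g by (auto simp: occurs_only_at_def)
  define v where "v j = (if j < c then 0 else i)" for j
  define f where "f j = (if j = c then 0 else g j)" for j
  define T where "T j =
    (if j < c then (if g j = 0 then Blank else Vertical)
     else if j = c then Elbow_EN
     else if g j = 0 then Horizontal else Cross)" for j
  have "T j \<in> allowed E_row \<and> (\<forall>s. uses (T j) s \<longleftrightarrow> side_label v g f j s \<noteq> 0) \<and>
       (if T j = Blank \<or> straight (T j) then v j = v (j - 1) \<and> f j = g j
        else v j = g j \<and> f j = v (j - 1)) \<and> T j \<noteq> Double_EN_SW \<and> (T j = Cross \<longrightarrow> v (j - 1) = i)"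
    if j: "j \<in> {1..n}" for j
  proof -
    consider "j < c" | "j = c" | "c < j" by linarith
    then show ?thesis
    proof cases
      case 1
      then have "v j = 0" "v (j - 1) = 0" by (simp_all add: v_def less_imp_diff_less)
      then show ?thesis using 1 by (simp add: T_def f_def all_side uses_iff straight_def)
    next
      case 2
      then have "v j = i" "v (j - 1) = 0" using c by (simp_all add: v_def)
      then show ?thesis using 2 c assms(2) by (simp add: T_def f_def all_side uses_iff straight_def)
    next
      case 3
      then have "v j = i" "v (j - 1) = i" by (auto simp: v_def)
      then show ?thesis using 3 assms(2) by (simp add: T_def f_def all_side uses_iff straight_def)
    qed
  qed
  moreover have "v 0 = 0" "v n = i" using c by (simp_all add: v_def)
  ultimately have "row_labelled n E_row i T v g f" "nongeneric_row n E_row i T v"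
    unfolding row_labelled_E nongeneric_row_def by blast+
  then show ?thesis by blast
qed

text \<open>Rows are added downward from the prescribed top labels. The multiplicities are part of
  the induction because the next row needs the unique column where its own pipe leaves.\<close>

lemma ex_nongeneric_rows:
  assumes g: "\<And>x. x \<noteq> 0 \<Longrightarrow> card {j\<in>{1..n}. g j = x} = of_bool (x \<le> m)" and "k \<le> m"
  shows "\<exists>T H V. H 0 = g \<and> (\<forall>x. x \<noteq> 0 \<longrightarrow> card {j\<in>{1..n}. H k j = x} = of_bool (k < x \<and> x \<le> m)) \<and>
    (\<forall>i\<in>{1..k}. row_labelled n (\<beta> i) i (T i) (V i) (H (i - 1)) (H i) \<and> nongeneric_row n (\<beta> i) i (T i) (V i))"
  using assms(2)
proof (induction k)
  case 0
  show ?case by (rule exI, rule exI[of _ "\<lambda>_. g"], rule exI) (use g in auto)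
next
  case (Suc k)
  obtain T H V where H0: "H 0 = g"
    and count': "\<forall>x. x \<noteq> 0 \<longrightarrow> card {j\<in>{1..n}. H k j = x} = of_bool (k < x \<and> x \<le> m)"
    and rows: "\<forall>i\<in>{1..k}. row_labelled n (\<beta> i) i (T i) (V i) (H (i - 1)) (H i) \<and>
      nongeneric_row n (\<beta> i) i (T i) (V i)"
    using Suc.IH[OF Suc_leD[OF Suc.prems]] by blast
  have count: "card {j\<in>{1..n}. H k j = x} = of_bool (k < x \<and> x \<le> m)" if "x \<noteq> 0" for x
    using count' that by blast
  have "card {j\<in>{1..n}. H k j = Suc k} = 1" using count[of "Suc k"] Suc.prems by simp
  then obtain c where "{j\<in>{1..n}. H k j = Suc k} = {c}" by (meson card_1_singletonE)
  then have "occurs_only_at {1..n} (H k) (Suc k) c" unfolding occurs_only_at_def by blast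
  then obtain t v f where t: "row_labelled n (\<beta> (Suc k)) (Suc k) t v (H k) f"
    "nongeneric_row n (\<beta> (Suc k)) (Suc k) t v"
    using ex_nongeneric_row_W[of n "H k" "Suc k" c] ex_nongeneric_row_E[of n "H k" "Suc k" c]
    by (cases "\<beta> (Suc k)") auto
  have "card {j\<in>{1..n}. f j = x} = of_bool (Suc k < x \<and> x \<le> m)" if "x \<noteq> 0" for x
  proof -
    have "of_bool (k < x \<and> x \<le> m) = of_bool (Suc k < x \<and> x \<le> m) + (of_bool (x = Suc k) :: nat)"
      using Suc.prems by (cases "x = Suc k") (auto simp: not_less_eq less_Suc_eq)
    then show ?thesis
      using row_labelled_count[OF t(1) that] unfolding count[OF that] by linarith
  qed
  moreover have "row_labelled n (\<beta> i) i ((T(Suc k := t)) i) ((V(Suc k := v)) i)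
        ((H(Suc k := f)) (i - 1)) ((H(Suc k := f)) i) \<and>
      nongeneric_row n (\<beta> i) i ((T(Suc k := t)) i) ((V(Suc k := v)) i)" if "i \<in> {1..Suc k}" for i
  proof (cases "i = Suc k")
    case True
    then show ?thesis using t by simp
  next
    case False
    then have "i \<in> {1..k}" "i - 1 \<noteq> Suc k" using that by auto
    then show ?thesis using rows False by simp
  qed
  ultimately show ?case
    using H0 by (intro exI[of _ "T(Suc k := t)"] exI[of _ "H(Suc k := f)"] exI[of _ "V(Suc k := v)"]) simp
qed

section \<open>Assembling the rows into a pipe dream\<close>

lemma row_labelled_cong:
  "(\<And>j. j \<in> {1..n} \<Longrightarrow> T j = T' j) \<Longrightarrow> row_labelled n b i T v g f \<longleftrightarrow> row_labelled n b i T' v g f"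
  unfolding row_labelled_def by simp

lemma (in labelled_filling) hybrid_genericI:
  assumes "1 \<le> m" "D \<in> extensional ({1..m} \<times> {1..n})"
  shows "D \<in> hybrid_generic m n \<beta>"
proof -
  have "D \<in> (\<Pi>\<^sub>E (i, j) \<in> {1..m} \<times> {1..n}. allowed (\<beta> i))"
    using assms(2) tile(1) by (auto simp: PiE_iff)
  moreover have "uses (D (i, j)) East \<longleftrightarrow> uses (D (i, j + 1)) West" if "i \<in> {1..m}" "j \<in> {1..<n}" for i j
    using tile(3)[of i j East] tile(3)[of i "j + 1" West] that by simp
  moreover have "uses (D (i, j)) South \<longleftrightarrow> uses (D (i + 1, j)) North" if "i \<in> {1..<m}" "j \<in> {1..n}" for i j
    using tile(3)[of i j South] tile(3)[of "i + 1" j North] that by simp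
  moreover have "uses (D (i, 1)) West \<and> \<not> uses (D (i, n)) East" if "i \<in> {1..m}" "\<beta> i = W_row" for i
    using tile(3)[of i 1 West] tile(3)[of i n East] row[OF that(1)] that n_pos by (simp add: row_labelled_W)
  moreover have "uses (D (i, n)) East \<and> \<not> uses (D (i, 1)) West" if "i \<in> {1..m}" "\<beta> i = E_row" for i
    using tile(3)[of i 1 West] tile(3)[of i n East] row[OF that(1)] that n_pos by (simp add: row_labelled_E)
  moreover have "\<not> uses (D (m, j)) South" if "j \<in> {1..n}" for j
    using tile(3)[of m j South] bottom[of j] that assms(1) by simp
  ultimately show ?thesis
    unfolding hybrid_generic_def by blast
qed

lemma nongeneric_dreams_nonempty:
  assumes "1 \<le> m" and \<pi>: "partial_perm m n \<pi>"
  shows "nongeneric_dreams m n \<beta> \<pi> \<noteq> {}"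
proof -
  have n: "1 \<le> n" using partial_perm_le[OF \<pi>] assms(1) by simp
  let ?I = "{1..m}"
  define c where "c p = \<pi> (pipe_number m \<beta> p)" for p
  have c: "c p \<in> {1..n}" if "p \<in> ?I" for p
    using \<pi> that bij_betwE[OF pipe_number_bij, of m \<beta>] by (auto simp: partial_perm_def c_def)
  have inj: "inj_on c ?I"
    using comp_inj_on[of "pipe_number m \<beta>" ?I \<pi>] pipe_number_bij[of m \<beta>] \<pi>
    by (auto simp: bij_betw_def partial_perm_def comp_def c_def[abs_def])
  \<comment> \<open>The top labels forced by \<open>\<pi>\<close>: a column carries the row whose
    pipe has to exit there.\<close>
  define g where "g j = (if j \<in> c ` ?I then inv_into ?I c j else 0)" for j
  have g: "g j = x \<longleftrightarrow> j = c x" if "x \<in> ?I" for j x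
    using that inj by (auto simp: g_def inv_into_f_f)
  have count: "card {j\<in>{1..n}. g j = x} = of_bool (x \<le> m)" if "x \<noteq> 0" for x
  proof (cases "x \<le> m")
    case True
    then have "{j\<in>{1..n}. g j = x} = {c x}" using g[of x] c[of x] that by auto
    then show ?thesis using True by simp
  next
    case False
    have "g j \<le> m" for j using inv_into_into[of j c ?I] by (auto simp: g_def)
    then have "{j\<in>{1..n}. g j = x} = {}" using False by auto
    then show ?thesis using False by simp
  qed
  obtain T H V where H0: "H 0 = g"
    and Hm: "\<And>x. x \<noteq> 0 \<Longrightarrow> card {j\<in>{1..n}. H m j = x} = of_bool (m < x \<and> x \<le> m)"
    and rows: "\<And>i. i \<in> {1..m} \<Longrightarrow> row_labelled n (\<beta> i) i (T i) (V i) (H (i - 1)) (H i)"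
      "\<And>i. i \<in> {1..m} \<Longrightarrow> nongeneric_row n (\<beta> i) i (T i) (V i)"
    using ex_nongeneric_rows[OF count order_refl, where \<beta> = \<beta>] by blast
  define D where "D = (\<lambda>(i, j)\<in>{1..m} \<times> {1..n}. T i j)"
  have DT: "D (i, j) = T i j" if "i \<in> {1..m}" "j \<in> {1..n}" for i j using that by (simp add: D_def)
  have bot: "H m j = 0" if "j \<in> {1..n}" for j
  proof (rule ccontr)
    assume "H m j \<noteq> 0"
    then have "card {j'\<in>{1..n}. H m j' = H m j} = 0" using Hm by simp
    then show False using that by (auto simp: card_eq_0_iff)
  qed
  have row: "row_labelled n (\<beta> i) i (\<lambda>j. D (i, j)) (V i) (H (i - 1)) (H i)" if "i \<in> {1..m}" for i
    using rows(1)[OF that] row_labelled_cong[of n "\<lambda>j. D (i, j)" "T i"] DT[OF that] by blast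
  have "labelling m n \<beta> D H V"
    using bot row by (simp add: labelling_def)
  then interpret labelled_filling m n \<beta> D H V
    using n by unfold_locales
  have "D \<in> hybrid_generic m n \<beta>"
    by (rule hybrid_genericI[OF assms(1)]) (simp add: D_def)
  moreover have "has_connectivity m n \<beta> D \<pi>"
    unfolding connectivity_label[OF \<pi>] H0 using g by (auto simp: c_def)
  moreover have "nongeneric m n \<beta> D"
    unfolding nongeneric_def
  proof (intro conjI ballI impI)
    fix i j assume ij: "i \<in> {1..m}" "j \<in> {1..n}"
    show "D (i, j) \<noteq> Vertical" if "\<beta> i = W_row"
      using rows(2)[OF ij(1)] ij(2) that DT[OF ij] by (simp add: nongeneric_row_def)
    show "D (i, j) \<noteq> Double_EN_SW" if "\<beta> i = E_row"
      using rows(2)[OF ij(1)] ij(2) that DT[OF ij] by (simp add: nongeneric_row_def)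
  next
    have less: "card (crossings m n \<beta> D p q) \<le> 1" if pq: "p \<in> {1..m}" "q \<in> {1..m}" "p < q" for p q
    proof -
      obtain a where a: "occurs_only_at {1..n} (H p) q a" using level_column[of p q] pq by auto
      \<comment> \<open>A cross in row \<open>i\<close> has horizontal label \<open>i\<close> and a
        larger vertical label, so \<open>i = p\<close>, and its column is the one where
        \<open>q\<close> lies below row \<open>p\<close>.\<close>
      have "crossings m n \<beta> D p q \<subseteq> {(p, a)}"
      proof (rule subsetI, clarify)
        fix i j assume "(i, j) \<in> crossings m n \<beta> D p q"
        then have ij: "i \<in> {1..m}" "j \<in> {1..n}" "D (i, j) = Cross"
          "V i (j - 1) = p \<and> H i j = q \<or> V i (j - 1) = q \<and> H i j = p"
          unfolding crossings_eq[OF pq(1,2)] by (auto simp: row_crossings_def meetings_def)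
        have "V i (j - 1) = i"
          using rows(2)[OF ij(1)] ij(2,3) DT[OF ij(1,2)] by (simp add: nongeneric_row_def)
        moreover have "i < H i j"
          using level_range(1)[of i j] Cross_distinct(3)[OF ij(1-3)] ij(1,2) by simp
        ultimately have "i = p" "H p j = q" using ij(4) pq(3) by auto
        then show "i = p \<and> j = a" using a ij(2) by (simp add: occurs_only_at_def)
      qed
      then have "card (crossings m n \<beta> D p q) \<le> card {(p, a)}" by (intro card_mono) simp_all
      then show ?thesis by simp
    qed
    fix p q assume pq: "p \<in> {1..m}" "q \<in> {1..m}" "p \<noteq> q"
    have sym: "crossings m n \<beta> D p q = crossings m n \<beta> D q p" unfolding crossings_def by blast
    show "card (crossings m n \<beta> D p q) \<le> 1"
      using less[of p q] less[of q p] sym pq by (cases "p < q") auto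
  qed
  ultimately show ?thesis
    by (auto simp: nongeneric_dreams_def generic_dreams_def)
qed

subsection \<open>Leading forms of weights\<close>

lemma B_lead_uminus:
  assumes "B_lead d p q"
  shows "B_lead d (- p) (- q)"
proof -
  have eq: "- p - - q = - (p - q)" by simp
  show ?thesis
    using assms unfolding B_lead_def eq keys_minus .
qed

lemma B_lead_B: "B_lead 1 B B"
  by (simp add: B_lead_def Var_def)

lemma B_lead_Var: "v \<noteq> VB \<Longrightarrow> B_lead 0 (Var v) (Var v)"
  by (simp add: B_lead_def Var_def lookup_single)

lemma B_lead_diff: "B_lead d p q \<Longrightarrow> B_lead d p' q' \<Longrightarrow> B_lead d (p - p') (q - q')"
  using B_lead_add[of d p q "- p'" "- q'"] B_lead_uminus[of d p' q'] by simp

lemma shift_linear: "shift (X k - Y j) = A + X k - Y j"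
  by (simp add: shift_def substitute_diff substitute_Var)

text \<open>Tiles without loss have leading term exactly \<open>B\<close>; tiles with loss have
  weight \<open>A + x - y\<close>, which is the shifted nongeneric factor.\<close>

lemma B_lead_tile_weight:
  "B_lead (1 - tile_loss (\<beta> i) (D (i, j))) (tile_weight m \<beta> D i j)
     (B ^ (1 - tile_loss (\<beta> i) (D (i, j))) * shift (nongeneric_tile_weight m \<beta> D i j))"
proof -
  let ?x = "X (pipe_number m \<beta> i)" and ?y = "Y j"
  have lin: "B_lead 0 (A + ?x - ?y) (A + ?x - ?y)"
    by (intro B_lead_diff B_lead_add B_lead_Var) simp_all
  have "B_lead 0 (?y - ?x) (?y - ?x)" by (intro B_lead_diff B_lead_Var) simp_all
  then have "B_lead 1 (B + (?y - ?x)) (B + 0)"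
    by (intro B_lead_add B_lead_B B_lead_zero[of 0]) simp_all
  then have B1: "B_lead 1 (B - ?x + ?y) B" by (simp add: algebra_simps)
  have "B_lead 1 (A + B) (0 + B)"
    by (intro B_lead_add B_lead_B B_lead_zero[OF B_lead_Var]) simp_all
  then have AB: "B_lead 1 (A + B) B" by simp
  have one: "shift 1 = 1" by (simp add: shift_def substitute_one)
  show ?thesis
    using lin B1 AB
    by (cases "\<beta> i"; cases "D (i, j)")
      (simp_all add: tile_weight_def nongeneric_tile_weight_def tile_loss_def straight_def Let_def
        shift_linear one)
qed

lemma loss_complement:
  "(\<Sum>(i, j)\<in>{1..m} \<times> {1..n}. 1 - tile_loss (\<beta> i) (D (i, j))) = m * n - loss m n \<beta> D"
  "loss m n \<beta> D \<le> m * n"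
proof -
  have le: "tile_loss (\<beta> i) (D (i, j)) \<le> 1" for i j by (simp add: tile_loss_def)
  have "(\<Sum>x\<in>{1..m} \<times> {1..n}. 1 - tile_loss (\<beta> (fst x)) (D x)) =
      (\<Sum>x\<in>{1..m} \<times> {1..n}. 1) - (\<Sum>x\<in>{1..m} \<times> {1..n}. tile_loss (\<beta> (fst x)) (D x))"
    by (intro sum_subtractf_nat) (use le in auto)
  then show "(\<Sum>(i, j)\<in>{1..m} \<times> {1..n}. 1 - tile_loss (\<beta> i) (D (i, j))) = m * n - loss m n \<beta> D"
    by (simp add: loss_def case_prod_unfold)
  have "loss m n \<beta> D \<le> (\<Sum>x\<in>{1..m} \<times> {1..n}. 1)"
    unfolding loss_def by (intro sum_mono) (use le in auto)
  then show "loss m n \<beta> D \<le> m * n" by simp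
qed

text \<open>Valid for every filling, so contributing and noncontributing dreams are told apart by
  their loss alone.\<close>

lemma B_lead_weight:
  "B_lead (m * n - loss m n \<beta> D) (weight m n \<beta> D)
     (B ^ (m * n - loss m n \<beta> D) * shift (nongeneric_weight m n \<beta> D))"
proof -
  let ?G = "{1..m} \<times> {1..n}"
  let ?d = "\<lambda>x. 1 - tile_loss (\<beta> (fst x)) (D x)"
  have "B_lead (\<Sum>x\<in>?G. ?d x) (\<Prod>x\<in>?G. tile_weight m \<beta> D (fst x) (snd x))
      (\<Prod>x\<in>?G. B ^ ?d x * shift (nongeneric_tile_weight m \<beta> D (fst x) (snd x)))"
    by (intro B_lead_prod) (use B_lead_tile_weight[of \<beta> _ D _ m] in auto)
  moreover have "(\<Sum>x\<in>?G. ?d x) = m * n - loss m n \<beta> D"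
    using loss_complement(1)[where m = m and n = n] by (simp add: case_prod_unfold)
  ultimately show ?thesis
    by (simp add: weight_def nongeneric_weight_def case_prod_unfold prod.distrib
        power_sum[symmetric] shift_def substitute_prod)
qed

text \<open>The values are constant polynomials, so \<open>substitute\<close> itself serves as
  evaluation.\<close>

fun eval_var :: "var \<Rightarrow> poly" where
  "eval_var VA = 0" | "eval_var VB = 1" | "eval_var (VX k) = 1" | "eval_var (VY k) = 0"

lemma eval_shift_nongeneric_weight:
  "substitute eval_var (B ^ N * shift (nongeneric_weight m n \<beta> D)) = 1"
proof -
  have "substitute eval_var (shift (nongeneric_tile_weight m \<beta> D i j)) = 1" for i j
    unfolding nongeneric_tile_weight_def
    by (simp add: shift_linear substitute_diff substitute_add substitute_Var)
      (simp add: shift_def substitute_one)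
  then show ?thesis
    by (simp add: nongeneric_weight_def shift_def substitute_prod substitute_mult substitute_power
        substitute_Var case_prod_unfold)
qed

theorem theorem4p5:
  fixes m n :: nat and \<pi> :: "nat \<Rightarrow> nat" and \<beta> :: "nat \<Rightarrow> row_type"
  assumes "1 \<le> m" and "m \<le> n" and "partial_perm m n \<pi>"
  defines "N \<equiv> m * n - inversions n (completion m n \<pi>)"
  shows "B_leading_form (G m n \<beta> \<pi>) = B ^ N * shift (S m n \<beta> \<pi>) \<and>
    (\<forall>D \<in> generic_dreams m n \<beta> \<pi>. \<not> nongeneric m n \<beta> D \<longrightarrow>
       B_degree (weight m n \<beta> D) < B_degree (G m n \<beta> \<pi>)) \<and>
    (\<forall>D \<in> nongeneric_dreams m n \<beta> \<pi>.
       B_leading_form (weight m n \<beta> D) = B ^ N * shift (nongeneric_weight m n \<beta> D))"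
proof -
  let ?lead = "\<lambda>D. B ^ N * shift (nongeneric_weight m n \<beta> D)"
  have loss: "inversions n (completion m n \<pi>) \<le> loss m n \<beta> D"
    "loss m n \<beta> D = inversions n (completion m n \<pi>) \<longleftrightarrow> nongeneric m n \<beta> D"
    if "D \<in> generic_dreams m n \<beta> \<pi>" for D
  proof -
    have n: "1 \<le> n" and D: "D \<in> hybrid_generic m n \<beta>" "has_connectivity m n \<beta> D \<pi>"
      using assms(1,2) that by (simp_all add: generic_dreams_def)
    obtain H V where "labelling m n \<beta> D H V" using ex_labelling[OF n D(1)] by blast
    then interpret labelled_filling m n \<beta> D H V using n by unfold_locales
    show "inversions n (completion m n \<pi>) \<le> loss m n \<beta> D"
      "loss m n \<beta> D = inversions n (completion m n \<pi>) \<longleftrightarrow> nongeneric m n \<beta> D"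
      using loss_eq_iff_nongeneric[OF assms(3) D(2)] by blast+
  qed
  have nongeneric: "B_lead N (weight m n \<beta> D) (?lead D)" if "D \<in> nongeneric_dreams m n \<beta> \<pi>" for D
    using loss(2)[of D] that B_lead_weight[of m n \<beta> D] by (simp add: nongeneric_dreams_def N_def)
  have generic: "m * n - loss m n \<beta> D < N"
    if "D \<in> generic_dreams m n \<beta> \<pi>" "\<not> nongeneric m n \<beta> D" for D
    using loss[OF that(1)] that(2) loss_complement(2)[of m n \<beta> D] unfolding N_def by linarith
  have lead_nz: "?lead D \<noteq> 0" for D
    using eval_shift_nongeneric_weight[of N m n \<beta> D] by (auto simp: substitute_zero)
  \<comment> \<open>Every dream gets a form for the same degree \<open>N\<close>, zero if its weight
    has lower degree, so that the forms can be summed.\<close>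
  let ?q = "\<lambda>D. if nongeneric m n \<beta> D then ?lead D else 0"
  have "B_lead N (G m n \<beta> \<pi>) (\<Sum>D\<in>generic_dreams m n \<beta> \<pi>. ?q D)"
    unfolding G_def
  proof (intro B_lead_sum finite_generic_dreams)
    show "B_lead N (weight m n \<beta> D) (?q D)" if "D \<in> generic_dreams m n \<beta> \<pi>" for D
      using that nongeneric[of D] B_lead_zero[OF B_lead_weight generic, of D]
      by (simp add: nongeneric_dreams_def)
  qed
  moreover have sum_q: "(\<Sum>D\<in>generic_dreams m n \<beta> \<pi>. ?q D) = (\<Sum>D\<in>nongeneric_dreams m n \<beta> \<pi>. ?lead D)"
    using finite_generic_dreams by (simp add: nongeneric_dreams_def sum.inter_filter)
  moreover have "(\<Sum>D\<in>nongeneric_dreams m n \<beta> \<pi>. ?lead D) = B ^ N * shift (S m n \<beta> \<pi>)"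
    by (simp add: S_def shift_def substitute_sum sum_distrib_left)
  ultimately have G: "B_lead N (G m n \<beta> \<pi>) (B ^ N * shift (S m n \<beta> \<pi>))"
    and S: "B ^ N * shift (S m n \<beta> \<pi>) = (\<Sum>D\<in>nongeneric_dreams m n \<beta> \<pi>. ?lead D)" by simp_all
  \<comment> \<open>The evaluation counts the nongeneric dreams; a positive count shows that the
    form does not vanish.\<close>
  have "substitute eval_var (B ^ N * shift (S m n \<beta> \<pi>)) = of_nat (card (nongeneric_dreams m n \<beta> \<pi>))"
    unfolding S substitute_sum by (simp add: eval_shift_nongeneric_weight)
  moreover have "card (nongeneric_dreams m n \<beta> \<pi>) \<noteq> 0"
    using nongeneric_dreams_nonempty[OF assms(1,3)] finite_generic_dreams
    by (simp add: nongeneric_dreams_def)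
  ultimately have nz: "B ^ N * shift (S m n \<beta> \<pi>) \<noteq> 0"
    by (auto simp: substitute_zero)
  have "B_degree (weight m n \<beta> D) < B_degree (G m n \<beta> \<pi>)"
    if "D \<in> generic_dreams m n \<beta> \<pi>" "\<not> nongeneric m n \<beta> D" for D
    using generic[OF that] B_degree_le[OF B_lead_weight, of m n \<beta> D] B_degree_eq[OF G nz] by simp
  then show ?thesis
    using B_leading_form_eq[OF G nz] B_leading_form_eq[OF nongeneric lead_nz] by blast
qed

end
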